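(* For real parameters $a,\lambda$ let $$p(x) = \frac{2a + 2a x^2 -4a^2 x^2}{( 1 - x^2 )^{2}} + \frac{8a\lambda x^2}{1 - x^2} - (4\lambda^2 x^2 + 2\lambda).$$ (A) Suppose $\lambda, a$ satisfy $$\frac{1 - 2a}{4} \le \lambda \le \frac{1}{2}\left[ (1+2a) - (1+6a)^{1/2} \right], \qquad \frac{1}{2} \le a \le 1 .$$ If $f$ is an analytic function in $\Delta$ satisfying $$| Sf(z) | \le 2 p( |z| ) , \qquad z \in \Delta ,$$ then $f$ is univalent in $\Delta$. (B) Suppose $\lambda, a$ satisfy the more restrictive conditions $$\max \left\{ \frac{1 - 2a}{4},\; a - \frac{1}{2} (6a)^{1/2} \right\} \le \lambda \le \frac{1}{2}\left[ (1+2a) - (1+6a)^{1/2} \right], \qquad \frac{1}{2} < a \le 1 .$$ Then $p(z)$ is self majorant, and the function $$f(z) = \int_0^z \frac{dt} { (1 - t^2)^{2a} \exp( 2\lambda t^2 ) }$$ is an odd univalent function in $\Delta$. (C) Moreover, if the more restrictive conditions on $\lambda, a$ stated in (B) are satisfied, then the univalence criterion $|Sf(z)| \le 2p(|z|)$, $z\in\Delta$, is sharp.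
   Context: $\Delta=\{z\in\mathbb{C}: |z|<1\}$ is the open unit disc. For an analytic locally univalent function $f$, the Schwarzian derivative is $Sf = \left(\frac{f''}{f'}\right)' - \frac12\left(\frac{f''}{f'}\right)^2$; a hypothesis on $Sf$ in $\Delta$ presupposes that $f$ is locally univalent in $\Delta$. Univalent means injective. The formula for $p$ is also used for complex argument $z\in\Delta$. An analytic function $p$ on $\Delta$ is called self majorant in $\Delta$ if $|p(z)|\le p(|z|)$ for all $z\in\Delta$. The univalence criterion $|Sf(z)|\le 2p(|z|)$, $z\in\Delta$, is called sharp if, for analytic (locally univalent) $f$ in $\Delta$, the conditions $Sf(x)\ge 2p(x)$ for $-1<x<1$ (in particular $Sf(x)$ is real there) and $Sf(z)\not\equiv 2p(z)$ imply that $f$ is not univalent in $\Delta$. The power $(1-t^2)^{2a}$ denotes the analytic branch in $\Delta$ equal to $1$ at $t=0$. *)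

theory Defs
  imports "HOL-Complex_Analysis.Complex_Analysis"
begin

definition schwarzian :: "(complex \<Rightarrow> complex) \<Rightarrow> complex \<Rightarrow> complex" where
  "schwarzian f z =
     deriv (\<lambda>w. deriv (deriv f) w / deriv f w) z - 1 / 2 * (deriv (deriv f) z / deriv f z)\<^sup>2"

definition locally_univalent_on :: "(complex \<Rightarrow> complex) \<Rightarrow> complex set \<Rightarrow> bool" where
  "locally_univalent_on f S \<longleftrightarrow> (\<forall>z\<in>S. \<exists>U. open U \<and> z \<in> U \<and> U \<subseteq> S \<and> inj_on f U)"

text \<open>Polymorphic, because the formula is used both for real and for complex arguments.\<close>

definition pfun :: "real \<Rightarrow> real \<Rightarrow> 'a::real_field \<Rightarrow> 'a" where
  "pfun a lam x =
     (of_real (2 * a) + of_real (2 * a) * x\<^sup>2 - of_real (4 * a\<^sup>2) * x\<^sup>2) / (1 - x\<^sup>2)\<^sup>2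
     + of_real (8 * a * lam) * x\<^sup>2 / (1 - x\<^sup>2)
     - (of_real (4 * lam\<^sup>2) * x\<^sup>2 + of_real (2 * lam))"

text \<open>For complex \<open>p\<close>, the inequality \<open>\<bar>p z\<bar> \<le> p \<bar>z\<bar>\<close> includes that its right-hand side is real.\<close>

definition self_majorant :: "(complex \<Rightarrow> complex) \<Rightarrow> bool" where
  "self_majorant p \<longleftrightarrow>
     p holomorphic_on ball 0 1 \<and>
     (\<forall>z\<in>ball 0 1. p (of_real (norm z)) \<in> \<real> \<and> norm (p z) \<le> Re (p (of_real (norm z))))"

text \<open>
  Sharpness of the criterion \<open>\<bar>Sf z\<bar> \<le> 2 p \<bar>z\<bar>\<close>. The function \<open>p\<close> is meant to be
  real on the interval \<open>(-1, 1)\<close>, hence \<open>Re\<close> on the right-hand side of the inequality.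
\<close>

definition sharp_criterion :: "(complex \<Rightarrow> complex) \<Rightarrow> bool" where
  "sharp_criterion p \<longleftrightarrow>
     (\<forall>f. f holomorphic_on ball 0 1 \<longrightarrow>
          locally_univalent_on f (ball 0 1) \<longrightarrow>
          (\<forall>x::real. -1 < x \<and> x < 1 \<longrightarrow>
             schwarzian f (of_real x) \<in> \<real> \<and>
             Re (schwarzian f (of_real x)) \<ge> 2 * Re (p (of_real x))) \<longrightarrow>
          (\<exists>z\<in>ball 0 1. schwarzian f z \<noteq> 2 * p z) \<longrightarrow>
          \<not> inj_on f (ball 0 1))"

text \<open>
  For \<open>\<bar>t\<bar> < 1\<close> the value \<open>1 - t\<^sup>2\<close> lies in the right half plane, so the principal branch
  used by \<open>powr\<close> is the analytic branch with value \<open>1\<close> at \<open>t = 0\<close>.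
\<close>

definition extremal :: "real \<Rightarrow> real \<Rightarrow> complex \<Rightarrow> complex" where
  "extremal a lam z =
     contour_integral (linepath 0 z)
       (\<lambda>t. 1 / ((1 - t\<^sup>2) powr of_real (2 * a) * exp (of_real (2 * lam) * t\<^sup>2)))"

end

theory Submission
  imports Defs
begin

text \<open>
  Everything rests on the linear equation \<open>y'' + q y = 0\<close>. For locally univalent \<open>f\<close>
  the function \<open>v = (f')\<^sup>-\<^sup>1\<^sup>/\<^sup>2\<close> solves it with \<open>q = Sf / 2\<close>, and so does every
  \<open>(\<alpha> f + \<beta>) v\<close>; hence \<open>f\<close> takes a value twice exactly when one of these solutions,
  not identically zero, has two zeros. For \<open>q = p\<close> the equation has on \<open>(-1, 1)\<close> the positive solution
  \<open>u(x) = (1 - x\<^sup>2)\<^sup>a exp (\<lambda> x\<^sup>2)\<close>, and \<open>u\<^sup>-\<^sup>2\<close> is the derivative of the extremal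
  function.

  Part (A) is Nehari's argument. Two points of the disc are joined by a hyperbolic geodesic. After a
  suitable automorphism \<open>T\<close> it is the interval \<open>(-1, 1)\<close>, with \<open>\<bar>T x\<bar> \<ge> \<bar>x\<bar>\<close>
  (\<open>geodesic_normal_form\<close>). The restrictions on the parameters ensure that
  \<open>(1 - x\<^sup>2)\<^sup>2 p x\<close> decreases on \<open>[0, 1)\<close> (\<open>pfun_weighted_antimono\<close>). Therefore the
  hypothesis on \<open>Sf\<close> survives the change of variable: on the interval the transformed equation
  has a coefficient bounded by \<open>p\<close>. Since the equation for \<open>p\<close> has a positive solution, no
  nontrivial solution of the transformed equation can vanish twice (\<open>disconjugate\<close>).

  Part (B): as a power series in \<open>z\<^sup>2\<close>, the function \<open>p\<close> has coefficients that are
  nonnegative under the stated conditions; the lower bound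
  \<open>a - (6a)\<^sup>1\<^sup>/\<^sup>2 / 2 \<le> \<lambda>\<close> is what makes the coefficient of \<open>z\<^sup>2\<close> nonnegative. Hence
  \<open>p\<close> is self majorant, and the extremal function, whose Schwarzian is \<open>2 p\<close>, is univalent
  by (A).

  Part (C) is a Sturm comparison in the other direction. The integral of \<open>u\<^sup>-\<^sup>2\<close> diverges at
  both ends of the interval because \<open>2 a \<ge> 1\<close>. If \<open>Sf / 2 \<ge> p\<close> on the interval, without equality
  everywhere, the solution with the same initial data as \<open>u\<close> at \<open>0\<close> is forced down to a zero
  on each side of \<open>0\<close> (\<open>common_zero_right\<close>), and so \<open>f\<close> takes a value twice.
\<close>

section \<open>The equation \<open>y'' + q y = 0\<close>\<close>

text \<open>
  The derivative is carried along as a second function, so that initial data and Wronskians can be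
  written without choosing derivatives. The type is general because the equation is needed both on
  the real interval and on the complex disc.
\<close>

definition solves_on ::
  "'a::real_normed_field set \<Rightarrow> ('a \<Rightarrow> 'a) \<Rightarrow> ('a \<Rightarrow> 'a) \<Rightarrow> ('a \<Rightarrow> 'a) \<Rightarrow> bool" where
  "solves_on I q y y' \<longleftrightarrow>
     (\<forall>x\<in>I. (y has_field_derivative y' x) (at x) \<and> (y' has_field_derivative - q x * y x) (at x))"

lemma solves_onD:
  assumes "solves_on I q y y'" "x \<in> I"
  shows "(y has_field_derivative y' x) (at x)" "(y' has_field_derivative - q x * y x) (at x)"
  using assms unfolding solves_on_def by auto

lemma solves_on_reflect:
  fixes y :: "real \<Rightarrow> real"
  assumes "solves_on {-1<..<1} q y y'"
  shows "solves_on {-1<..<1} (\<lambda>x. q (- x)) (\<lambda>x. y (- x)) (\<lambda>x. - y' (- x))"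
  unfolding solves_on_def
proof (intro ballI conjI)
  fix x :: real assume "x \<in> {-1<..<1}"
  then have x: "- x \<in> {-1<..<1}" by auto
  have m: "(uminus has_real_derivative -1) (at x)"
    by (auto intro!: derivative_eq_intros)
  show "((\<lambda>x. y (- x)) has_real_derivative - y' (- x)) (at x)"
    using DERIV_chain2[OF solves_onD(1)[OF assms x] m] by simp
  show "((\<lambda>x. - y' (- x)) has_real_derivative - q (- x) * y (- x)) (at x)"
    using DERIV_minus[OF DERIV_chain2[OF solves_onD(2)[OF assms x] m]] by simp
qed

text \<open>
  Let \<open>h = u'/u\<close> and \<open>W = A + i B\<close>, a solution of \<open>W'' + q W = 0\<close> for the complex coefficient
  \<open>q = qr + i qi\<close>. By the Riccati equation \<open>h' = - p - h\<^sup>2\<close>, the derivative of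
  \<open>G = Re (cnj W W') - h \<bar>W\<bar>\<^sup>2\<close> is \<open>\<bar>W' - h W\<bar>\<^sup>2 + (p - Re q) \<bar>W\<bar>\<^sup>2 \<ge> 0\<close>.
  Between two zeros of \<open>W\<close> this \<open>G\<close> rises from \<open>0\<close> to \<open>0\<close>, so
  \<open>W' = h W\<close> and \<open>W / u\<close> is constant. Writing \<open>W\<close> in real and imaginary parts keeps the argument
  within real calculus.
\<close>

lemma disconjugate:
  fixes u u' p :: "real \<Rightarrow> real"
  assumes u: "solves_on {-1<..<1} p u u'" "\<And>x. x \<in> {-1<..<1} \<Longrightarrow> u x > 0"
    and A: "\<And>x. x \<in> {-1<..<1} \<Longrightarrow> (A has_real_derivative A1 x) (at x)"
           "\<And>x. x \<in> {-1<..<1} \<Longrightarrow> (A1 has_real_derivative - (qr x * A x - qi x * B x)) (at x)"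
    and B: "\<And>x. x \<in> {-1<..<1} \<Longrightarrow> (B has_real_derivative B1 x) (at x)"
           "\<And>x. x \<in> {-1<..<1} \<Longrightarrow> (B1 has_real_derivative - (qr x * B x + qi x * A x)) (at x)"
    and q: "\<And>x. x \<in> {-1<..<1} \<Longrightarrow> qr x \<le> p x"
    and ab: "-1 < a" "a < b" "b < 1"
    and zero: "A a = 0" "B a = 0" "A b = 0" "B b = 0"
    and x: "x \<in> {a..b}"
  shows "A x = 0" "B x = 0"
proof -
  define h where "h x = u' x / u x" for x
  define G where "G x = A x * A1 x + B x * B1 x - h x * ((A x)\<^sup>2 + (B x)\<^sup>2)" for x
  define G1 where "G1 x = (A1 x - h x * A x)\<^sup>2 + (B1 x - h x * B x)\<^sup>2
      + (p x - qr x) * ((A x)\<^sup>2 + (B x)\<^sup>2)" for x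
  have dh: "(h has_real_derivative - p x - (h x)\<^sup>2) (at x)" if "x \<in> {-1<..<1}" for x
    unfolding h_def
    by (rule derivative_eq_intros solves_onD[OF u(1) that] refl)+
       (use u(2)[OF that] in \<open>auto simp: field_simps power2_eq_square\<close>)
  have dG: "(G has_real_derivative G1 x) (at x)" if x: "x \<in> {-1<..<1}" for x
    unfolding G_def G1_def
    by (rule derivative_eq_intros A[OF x] B[OF x] dh[OF x] refl)+
       (simp add: algebra_simps power2_eq_square)
  have G1: "G1 x \<ge> 0" if "x \<in> {-1<..<1}" for x
    unfolding G1_def using q[OF that] by (intro add_nonneg_nonneg mult_nonneg_nonneg) auto
  have mono: "G s \<le> G t" if "a \<le> s" "s \<le> t" "t \<le> b" for s t
    by (rule DERIV_nonneg_imp_nondecreasing[OF \<open>s \<le> t\<close>]) (use that ab dG G1 in force)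
  have G0: "G x = 0" if "x \<in> {a..b}" for x
    using mono[of a x] mono[of x b] that zero by (auto simp: G_def)
  have G10: "G1 x = 0" if x: "a < x" "x < b" for x
  proof -
    have "(G has_real_derivative 0) (at x)"
      by (rule has_field_derivative_transform_within_open[OF DERIV_const, of "{a<..<b}" _ 0])
         (use G0 x in auto)
    with dG[of x] ab x show ?thesis by (auto dest: DERIV_unique)
  qed
  have A1: "A1 x = h x * A x" "B1 x = h x * B x" if x: "a < x" "x < b" for x
  proof -
    have "(p x - qr x) * ((A x)\<^sup>2 + (B x)\<^sup>2) \<ge> 0"
      using q[of x] ab x by (intro mult_nonneg_nonneg) auto
    then have "(A1 x - h x * A x)\<^sup>2 + (B1 x - h x * B x)\<^sup>2 \<le> 0"
      using G10[OF x] unfolding G1_def by linarith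
    then show "A1 x = h x * A x" "B1 x = h x * B x"
      by (simp_all add: sum_power2_le_zero_iff)
  qed
  have const: "y x = 0"
    if dy: "\<And>x. x \<in> {-1<..<1} \<Longrightarrow> (y has_real_derivative y1 x) (at x)"
      and y1: "\<And>x. a < x \<Longrightarrow> x < b \<Longrightarrow> y1 x = h x * y x" and y0: "y a = 0" for y y1
  proof -
    have d: "((\<lambda>x. y x / u x) has_real_derivative (y1 x - h x * y x) / u x) (at x)"
      if "x \<in> {-1<..<1}" for x
      by (rule derivative_eq_intros solves_onD[OF u(1) that] dy[OF that] refl)+
         (use u(2)[OF that] in \<open>auto simp: field_simps h_def\<close>)
    have "y x / u x = y a / u a"
    proof (rule DERIV_isconst2[OF \<open>a < b\<close>])
      show "continuous_on {a..b} (\<lambda>x. y x / u x)"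
        by (rule DERIV_continuous_on, rule has_field_derivative_at_within, rule d) (use ab in auto)
      show "((\<lambda>x. y x / u x) has_real_derivative 0) (at x)" if "a < x" "x < b" for x
        using d[of x] y1[of x] that ab by auto
    qed (use x in auto)
    with y0 u(2)[of x] ab x show ?thesis by auto
  qed
  show "A x = 0" by (rule const[OF A(1) A1(1) zero(1)])
  show "B x = 0" by (rule const[OF B(1) A1(2) zero(2)])
qed

text \<open>
  Sturm comparison at a singular end point. As long as \<open>y\<close> stays positive, the Wronskian
  \<open>D = y' u - y u'\<close> decreases from \<open>0\<close>, and strictly near \<open>x1\<close>; so eventually \<open>D \<le> - \<delta>\<close>
  with \<open>\<delta> > 0\<close>, and \<open>(y / u)' = D / u\<^sup>2\<close> is at most a negative multiple of
  \<open>1 / (1 - x)\<close>, whose integral diverges. Hence \<open>y\<close> must vanish.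

  The second solution \<open>s\<close> will be the imaginary part of a complex solution with real initial data.
  It vanishes with \<open>y\<close> at the first zero of \<open>y\<close>: the Wronskian of \<open>y\<close> and \<open>s\<close> is \<open>0\<close>, so
  \<open>s / y\<close> is constant, hence \<open>0\<close>, up to that zero.
\<close>

lemma common_zero_right:
  fixes u u' p q y y' s s' :: "real \<Rightarrow> real"
  assumes u: "solves_on {-1<..<1} p u u'" "\<And>x. x \<in> {-1<..<1} \<Longrightarrow> u x > 0"
    and M: "\<And>x. x \<in> {-1<..<1} \<Longrightarrow> (u x)\<^sup>2 \<le> M * (1 - x\<^sup>2)"
    and y: "solves_on {-1<..<1} q y y'" "y 0 = u 0" "y' 0 = u' 0"
    and s: "solves_on {-1<..<1} q s s'" "s 0 = 0" "s' 0 = 0"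
    and pq: "\<And>x. x \<in> {-1<..<1} \<Longrightarrow> p x \<le> q x"
    and x1: "0 < x1" "x1 < 1" "p x1 < q x1"
  shows "\<exists>x. 0 < x \<and> x < 1 \<and> y x = 0 \<and> s x = 0"
proof -
  have y0: "y 0 > 0" using y u(2)[of 0] by simp
  have cont: "continuous_on {0..r} y" "continuous_on {0..r} s" if "r < 1" for r
    by (rule DERIV_continuous_on, rule has_field_derivative_at_within,
        rule solves_onD(1)[OF y(1)] solves_onD(1)[OF s(1)], use that in auto)+
  have "\<exists>x. 0 < x \<and> x < 1 \<and> y x \<le> 0"
  proof (rule ccontr)
    assume "\<not> ?thesis"
    then have pos: "y x > 0" if "0 \<le> x" "x < 1" for x
      using that y0 by (cases "x = 0") force+
    define D where "D x = y' x * u x - y x * u' x" for x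
    have dD: "(D has_real_derivative - (q x - p x) * (u x * y x)) (at x)" if x: "x \<in> {-1<..<1}" for x
      unfolding D_def
      by (rule derivative_eq_intros solves_onD[OF u(1) x] solves_onD[OF y(1) x] refl)+
         (simp add: algebra_simps)
    have Dmono: "D t \<le> D r" if "0 \<le> r" "r \<le> t" "t < 1" for r t
    proof (rule DERIV_nonpos_imp_nonincreasing[OF \<open>r \<le> t\<close>])
      fix x assume "r \<le> x" "x \<le> t"
      then have x: "x \<in> {-1<..<1}" "0 \<le> x" "x < 1" using that by auto
      have "0 \<le> (q x - p x) * (u x * y x)"
        using pq[OF x(1)] u(2)[OF x(1)] pos[OF x(2,3)] by (intro mult_nonneg_nonneg) auto
      then have "- (q x - p x) * (u x * y x) \<le> 0" by (subst mult_minus_left) linarith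
      with dD[OF x(1)] show "\<exists>d. (D has_real_derivative d) (at x) \<and> d \<le> 0" by blast
    qed
    have "D x1 \<le> 0" using Dmono[of 0 x1] x1 y by (simp add: D_def)
    moreover obtain e where e: "e > 0" "\<And>h. 0 < h \<Longrightarrow> h < e \<Longrightarrow> D (x1 + h) < D x1"
    proof -
      have "0 < (q x1 - p x1) * (u x1 * y x1)"
        using x1 u(2)[of x1] pos[of x1] by (intro mult_pos_pos) auto
      then have "- (q x1 - p x1) * (u x1 * y x1) < 0" by (subst mult_minus_left) linarith
      from DERIV_neg_dec_right[OF dD this] x1 that show thesis by auto
    qed
    define x2 where "x2 = x1 + min (e / 2) ((1 - x1) / 2)"
    have x2: "x1 < x2" "x2 < 1" "x2 - x1 < e"
      using e(1) x1 by (auto simp: x2_def min_def field_simps)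
    define \<delta> where "\<delta> = - D x2"
    have "D x2 < D x1" using e(2)[of "x2 - x1"] x2 by simp
    ultimately have \<delta>: "\<delta> > 0" by (simp add: \<delta>_def)
    have Mpos: "M > 0"
      using M[of 0] u(2)[of 0] by (smt (verit) greaterThanLessThan_iff zero_power2 zero_less_power mult_cancel_left1)
    \<comment> \<open>Since \<open>u\<^sup>2 \<le> M (1 - x\<^sup>2) \<le> 2 M (1 - x)\<close>, this \<open>c\<close> satisfies \<open>\<delta> / u\<^sup>2 \<ge> c / (1 - x)\<close>.\<close>
    define c where "c = \<delta> / (2 * M)"
    have c: "c > 0" using \<delta> Mpos by (simp add: c_def)
    define K where "K x = y x / u x - c * ln (1 - x)" for x
    have dK: "(K has_real_derivative D x / (u x)\<^sup>2 + c / (1 - x)) (at x)" if x: "0 \<le> x" "x < 1" for x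
    proof -
      have x': "x \<in> {-1<..<1}" using x by simp
      have "((\<lambda>x. y x / u x) has_real_derivative D x / (u x)\<^sup>2) (at x)"
        using DERIV_divide[OF solves_onD(1)[OF y(1) x'] solves_onD(1)[OF u(1) x']] u(2)[OF x']
        by (simp add: D_def power2_eq_square)
      moreover have "((\<lambda>x. ln (1 - x)) has_real_derivative - 1 / (1 - x)) (at x)"
        using x by (auto intro!: derivative_eq_intros)
      ultimately show ?thesis unfolding K_def
        using DERIV_diff[OF _ DERIV_cmult] by fastforce
    qed
    have Kmono: "K t \<le> K x2" if "x2 \<le> t" "t < 1" for t
    proof (rule DERIV_nonpos_imp_nonincreasing[OF \<open>x2 \<le> t\<close>])
      fix x assume "x2 \<le> x" "x \<le> t"
      then have x: "x \<in> {-1<..<1}" "0 \<le> x" "x < 1" "x2 \<le> x" using that x1 x2 by auto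
      have u2: "(u x)\<^sup>2 > 0" using u(2)[OF x(1)] by simp
      have "(u x)\<^sup>2 \<le> M * (1 - x\<^sup>2)" by (rule M[OF x(1)])
      also have "\<dots> = M * ((1 + x) * (1 - x))" by (simp add: algebra_simps power2_eq_square)
      also have "\<dots> \<le> M * (2 * (1 - x))" using x Mpos by (intro mult_left_mono mult_right_mono) auto
      finally have "c * (u x)\<^sup>2 \<le> c * (M * (2 * (1 - x)))" using c by simp
      also have "\<dots> = \<delta> * (1 - x)" using Mpos by (simp add: c_def field_simps)
      finally have "c / (1 - x) \<le> \<delta> / (u x)\<^sup>2" using x u2 by (simp add: field_simps)
      moreover have "D x / (u x)\<^sup>2 \<le> - \<delta> / (u x)\<^sup>2"
        using Dmono[of x2 x] x x1 x2 u2 by (intro divide_right_mono) (auto simp: \<delta>_def)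
      ultimately have "D x / (u x)\<^sup>2 + c / (1 - x) \<le> 0" by simp
      with dK[OF x(2,3)] show "\<exists>d. (K has_real_derivative d) (at x) \<and> d \<le> 0" by blast
    qed
    \<comment> \<open>At this point \<open>y t / u t \<le> K x2 + c ln (1 - t)\<close> is no longer positive.\<close>
    define t where "t = max x2 (1 - exp (- K x2 / c))"
    have t: "x2 \<le> t" "t < 1" "0 \<le> t" using x1 x2 by (auto simp: t_def)
    have "ln (1 - t) \<le> ln (exp (- K x2 / c))"
      using t by (subst ln_le_cancel_iff) (auto simp: t_def)
    then have "ln (1 - t) \<le> - K x2 / c" by simp
    then have "c * ln (1 - t) \<le> - K x2"
      using c by (simp add: field_simps)
    with Kmono[OF t(1,2)] have "y t / u t \<le> 0" by (simp add: K_def)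
    moreover have "y t / u t > 0" using pos[OF t(3,2)] u(2)[of t] t by simp
    ultimately show False by simp
  qed
  then obtain t where t: "0 < t" "t < 1" "y t \<le> 0" by auto
  define Z where "Z = {0..t} \<inter> y -` {0}"
  have cl: "closed Z" unfolding Z_def
    by (rule continuous_closed_preimage[OF cont(1)[OF t(2)]]) auto
  have "\<exists>x\<ge>0. x \<le> t \<and> y x = 0"
    by (rule IVT2') (use t y0 cont(1)[of t] in auto)
  then have ne: "Z \<noteq> {}" by (auto simp: Z_def)
  have bb: "bdd_below Z" by (auto simp: Z_def)
  define x where "x = Inf Z"
  have xZ: "x \<in> Z" unfolding x_def by (rule closed_contains_Inf[OF ne bb cl])
  have x: "0 < x" "x \<le> t" "y x = 0" using xZ y0 by (auto simp: Z_def less_le)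
  have pos: "y r > 0" if r: "0 \<le> r" "r < x" for r
  proof (rule ccontr)
    assume "\<not> ?thesis"
    then have "\<exists>z\<ge>0. z \<le> r \<and> y z = 0"
      by (intro IVT2') (use r x t y0 cont(1)[of r] in auto)
    then obtain z where "z \<ge> 0" "z \<le> r" "y z = 0" by auto
    then have "z \<in> Z" using r x by (auto simp: Z_def)
    from cInf_lower[OF this bb] show False using \<open>z \<le> r\<close> r by (simp add: x_def)
  qed
  have W: "s' r * y r - s r * y' r = 0" if r: "0 \<le> r" "r < x" for r
  proof (cases "r = 0")
    case False
    have d: "((\<lambda>r. s' r * y r - s r * y' r) has_real_derivative 0) (at r)" if "r \<in> {-1<..<1}" for r
      by (rule derivative_eq_intros solves_onD[OF s(1) that] solves_onD[OF y(1) that] refl)+ simp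
    have "continuous_on {0..r} (\<lambda>r. s' r * y r - s r * y' r)"
      by (rule DERIV_continuous_on[where D = "\<lambda>_. 0"], rule has_field_derivative_at_within, rule d)
         (use r x t in auto)
    then have "s' r * y r - s r * y' r = s' 0 * y 0 - s 0 * y' 0"
      by (rule DERIV_isconst_end[of 0 r "\<lambda>r. s' r * y r - s r * y' r", rotated]; (intro d)?)
         (use False r x t in auto)
    then show ?thesis using s by simp
  qed (use s in auto)
  have s0: "s r = 0" if r: "0 \<le> r" "r < x" for r
  proof (cases "r = 0")
    case False
    have d: "((\<lambda>r. s r / y r) has_real_derivative 0) (at r)" if "0 \<le> r" "r < x" for r
    proof -
      have r': "r \<in> {-1<..<1}" using that x t by auto
      show ?thesis
        by (rule derivative_eq_intros solves_onD[OF s(1) r'] solves_onD[OF y(1) r'] refl)+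
           (use pos[OF that] W[OF that] in auto)
    qed
    have "continuous_on {0..r} (\<lambda>r. s r / y r)"
      by (rule DERIV_continuous_on[where D = "\<lambda>_. 0"], rule has_field_derivative_at_within, rule d)
         (use r in auto)
    then have "s r / y r = s 0 / y 0"
      by (rule DERIV_isconst_end[of 0 r "\<lambda>r. s r / y r", rotated]; (intro d)?)
         (use False r in auto)
    then show ?thesis using pos[OF r] s by simp
  qed (use s in auto)
  have "s x = 0"
  proof (rule continuous_constant_on_closure[of "{0..<x}" s])
    show "continuous_on (closure {0..<x}) s" using cont(2)[of x] x t by auto
  qed (use s0 x in auto)
  with x t show ?thesis by (intro exI[of _ x]) auto
qed

section \<open>The Schwarzian derivative as a coefficient\<close>

text \<open>
  The Schwarzian in terms of \<open>g = f'\<close> and the logarithmic derivative \<open>k = f''/f'\<close>, so that a closed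
  form of \<open>f'\<close> suffices to compute it.
\<close>

lemma schwarzian_eq:
  assumes S: "open S" "z \<in> S"
    and f: "\<And>w. w \<in> S \<Longrightarrow> (f has_field_derivative g w) (at w)"
    and g: "\<And>w. w \<in> S \<Longrightarrow> (g has_field_derivative g w * k w) (at w)" "\<And>w. w \<in> S \<Longrightarrow> g w \<noteq> 0"
    and k: "(k has_field_derivative k') (at z)"
  shows "schwarzian f z = k' - (k z)\<^sup>2 / 2"
proof -
  have f1: "deriv f w = g w" if "w \<in> S" for w
    using f[OF that] by (rule DERIV_imp_deriv)
  have f2: "deriv (deriv f) w = g w * k w" if "w \<in> S" for w
    by (rule DERIV_imp_deriv, rule has_field_derivative_transform_within_open[OF g(1)[OF that] S(1) that])
       (simp add: f1)
  have eq: "deriv (deriv f) w / deriv f w = k w" if "w \<in> S" for w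
    using that g(2) by (simp add: f1 f2)
  have "deriv (\<lambda>w. deriv (deriv f) w / deriv f w) z = k'"
    by (rule DERIV_imp_deriv, rule has_field_derivative_transform_within_open[OF k S]) (simp add: eq)
  with eq[OF S(2)] show ?thesis by (simp add: schwarzian_def)
qed

lemma locally_univalent_deriv_nonzero:
  assumes "f holomorphic_on S" "locally_univalent_on f S" "z \<in> S"
  shows "deriv f z \<noteq> 0"
proof -
  obtain U where "open U" "z \<in> U" "U \<subseteq> S" "inj_on f U"
    using assms unfolding locally_univalent_on_def by blast
  then show ?thesis
    using assms(1) by (intro holomorphic_injective_imp_regular[of f U]) (auto intro: holomorphic_on_subset)
qed

text \<open>
  The disc is contractible and \<open>f'\<close> has no zeros, so \<open>1 / f' = v\<^sup>2\<close> for some holomorphic \<open>v\<close>.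
  Then \<open>f''/f' = - 2 v'/v\<close>, and differentiating once more gives \<open>Sf = - 2 v''/v\<close>.
\<close>

lemma schwarzian_linearisation:
  assumes f: "f holomorphic_on ball 0 1" "locally_univalent_on f (ball 0 1)"
  obtains v v' where "solves_on (ball 0 1) (\<lambda>z. schwarzian f z / 2) v v'"
    "\<And>z. z \<in> ball 0 1 \<Longrightarrow> deriv f z * (v z)\<^sup>2 = 1"
proof -
  have "(\<lambda>z. 1 / deriv f z) holomorphic_on ball 0 1"
    using locally_univalent_deriv_nonzero[OF f] f by (intro holomorphic_intros) auto
  moreover have "contractible (ball (0 :: complex) 1)"
    by (intro convex_imp_contractible convex_ball)
  ultimately obtain v where v: "v holomorphic_on ball 0 1"
      "\<And>z. z \<in> ball 0 1 \<Longrightarrow> 1 / deriv f z = (v z)\<^sup>2"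
    by (rule contractible_imp_holomorphic_sqrt)
      (use locally_univalent_deriv_nonzero[OF f] in auto)
  have dv: "(v has_field_derivative deriv v z) (at z)"
    "(deriv v has_field_derivative deriv (deriv v) z) (at z)" if "z \<in> ball 0 1" for z
    using v(1) that by (auto intro!: holomorphic_derivI[of _ "ball 0 1"] holomorphic_intros)
  have fv: "deriv f z * (v z)\<^sup>2 = 1" and v0: "v z \<noteq> 0" and f': "deriv f z = 1 / (v z)\<^sup>2"
    if z: "z \<in> ball 0 1" for z
  proof -
    show 1: "v z \<noteq> 0" using v(2)[OF z] locally_univalent_deriv_nonzero[OF f z] by auto
    show 2: "deriv f z * (v z)\<^sup>2 = 1"
      using locally_univalent_deriv_nonzero[OF f z] by (simp flip: v(2)[OF z])
    show "deriv f z = 1 / (v z)\<^sup>2" using 1 2 by (simp add: eq_divide_eq)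
  qed
  have "deriv (deriv v) z = - (schwarzian f z / 2) * v z" if z: "z \<in> ball 0 1" for z
  proof -
    have "schwarzian f z
        = (-2 * (deriv (deriv v) z * v z - (deriv v z)\<^sup>2) / (v z)\<^sup>2) - (- 2 * deriv v z / v z)\<^sup>2 / 2"
    proof (rule schwarzian_eq[of "ball 0 1" z f "\<lambda>z. 1 / (v z)\<^sup>2"])
      show "(f has_field_derivative 1 / (v w)\<^sup>2) (at w)" if "w \<in> ball 0 1" for w
        using holomorphic_derivI[OF f(1) open_ball that] f'[OF that] by simp
      show "((\<lambda>z. 1 / (v z)\<^sup>2) has_field_derivative 1 / (v w)\<^sup>2 * (- 2 * deriv v w / v w)) (at w)"
        if "w \<in> ball 0 1" for w
        by (rule derivative_eq_intros dv[OF that] refl)+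
           (use v0[OF that] in \<open>auto simp: field_simps power2_eq_square\<close>)
      show "((\<lambda>z. - 2 * deriv v z / v z) has_field_derivative
          -2 * (deriv (deriv v) z * v z - (deriv v z)\<^sup>2) / (v z)\<^sup>2) (at z)"
        by (rule derivative_eq_intros dv[OF z] refl)+
           (use v0[OF z] in \<open>auto simp: field_simps power2_eq_square\<close>)
    qed (use z v0 in auto)
    then show ?thesis using v0[OF z] by (simp add: field_simps power2_eq_square)
  qed
  then have "solves_on (ball 0 1) (\<lambda>z. schwarzian f z / 2) v (deriv v)"
    using dv unfolding solves_on_def by metis
  then show thesis using that fv by blast
qed

text \<open>
  Differentiating \<open>f' v\<^sup>2 = 1\<close> yields \<open>f'' v + 2 f' v' = 0\<close>, which is exactly the extra term in
  \<open>(f v)''\<close>.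
\<close>

lemma solves_on_combination:
  fixes f v :: "complex \<Rightarrow> complex"
  assumes f: "f holomorphic_on S" "open S"
    and v: "solves_on S q v v'" "\<And>z. z \<in> S \<Longrightarrow> deriv f z * (v z)\<^sup>2 = 1"
  shows "solves_on S q (\<lambda>z. (\<alpha> * f z + \<beta>) * v z) (\<lambda>z. \<alpha> / v z + (\<alpha> * f z + \<beta>) * v' z)"
  unfolding solves_on_def
proof (intro ballI conjI)
  fix z assume z: "z \<in> S"
  have v0: "v z \<noteq> 0" using v(2)[OF z] by auto
  then have f': "deriv f z = 1 / (v z)\<^sup>2" using v(2)[OF z] by (simp add: eq_divide_eq)
  have df: "(f has_field_derivative 1 / (v z)\<^sup>2) (at z)"
    using holomorphic_derivI[OF f(1,2) z] f' by simp
  show "((\<lambda>z. (\<alpha> * f z + \<beta>) * v z) has_field_derivative \<alpha> / v z + (\<alpha> * f z + \<beta>) * v' z) (at z)"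
    by (rule derivative_eq_intros df solves_onD[OF v(1) z] refl)+
       (use v0 in \<open>simp add: field_simps power2_eq_square\<close>)
  show "((\<lambda>z. \<alpha> / v z + (\<alpha> * f z + \<beta>) * v' z) has_field_derivative
      - q z * ((\<alpha> * f z + \<beta>) * v z)) (at z)"
    by (rule derivative_eq_intros df solves_onD[OF v(1) z] refl v0)+
       (use v0 in \<open>simp add: field_simps power2_eq_square\<close>)
qed

lemma DERIV_Re_Im_of_real:
  assumes "(w has_field_derivative w') (at (of_real x))"
  shows "((\<lambda>x. Re (w (of_real x))) has_real_derivative Re w') (at x)"
    and "((\<lambda>x. Im (w (of_real x))) has_real_derivative Im w') (at x)"
proof -
  have d: "((\<lambda>x. w (of_real x)) has_vector_derivative w') (at x)"
    using has_vector_derivative_real_field[OF assms] by simp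
  show "((\<lambda>x. Re (w (of_real x))) has_real_derivative Re w') (at x)"
    by (rule has_field_derivative_Re[OF d])
  show "((\<lambda>x. Im (w (of_real x))) has_real_derivative Im w') (at x)"
    by (rule has_field_derivative_Im[OF d])
qed

section \<open>Disc automorphisms and geodesics\<close>

text \<open>
  For \<open>\<bar>k\<bar> = 1\<close> and \<open>\<bar>c\<bar> < 1\<close> these are the conformal automorphisms of the unit disc. The
  image of \<open>(-1, 1)\<close> is the geodesic through \<open>k c\<close>, the image of \<open>0\<close>.
\<close>

definition disc_aut :: "complex \<Rightarrow> complex \<Rightarrow> complex \<Rightarrow> complex" where
  "disc_aut k c z = k * (z + c) / (1 + cnj c * z)"

lemma disc_aut_denominator_nonzero:
  assumes "norm c < 1" "norm z < 1"
  shows "1 + cnj c * z \<noteq> 0"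
proof
  assume "1 + cnj c * z = 0"
  then have "cnj c * z = -1" by (simp add: add_eq_0_iff)
  then have "norm c * norm z = 1" by (metis complex_mod_cnj norm_minus_cancel norm_mult norm_one)
  moreover have "norm c * norm z \<le> norm c * 1" using assms by (intro mult_left_mono) auto
  ultimately show False using assms by simp
qed

text \<open>
  This is the invariance of the hyperbolic metric, since the derivative of the automorphism has
  modulus \<open>(1 - \<bar>c\<bar>\<^sup>2) / \<bar>1 + cnj c z\<bar>\<^sup>2\<close>.
\<close>

lemma disc_aut_norm:
  assumes "norm k = 1" "norm c < 1" "norm z < 1"
  shows "(norm (1 + cnj c * z))\<^sup>2 * (1 - (norm (disc_aut k c z))\<^sup>2) = (1 - (norm z)\<^sup>2) * (1 - (norm c)\<^sup>2)"
proof -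
  have "(norm (1 + cnj c * z))\<^sup>2 * (1 - (norm (disc_aut k c z))\<^sup>2)
      = (norm (1 + cnj c * z))\<^sup>2 - (norm (z + c))\<^sup>2"
    using assms disc_aut_denominator_nonzero[OF assms(2,3)]
    by (simp add: disc_aut_def norm_mult norm_divide power_divide right_diff_distrib)
  also have "\<dots> = (1 - (norm z)\<^sup>2) * (1 - (norm c)\<^sup>2)"
    by (simp add: cmod_power2) (simp add: algebra_simps power2_eq_square)
  finally show ?thesis .
qed

lemma disc_aut_in_ball:
  assumes "norm k = 1" "norm c < 1" "norm z < 1"
  shows "norm (disc_aut k c z) < 1"
proof -
  have "0 < (1 - (norm z)\<^sup>2) * (1 - (norm c)\<^sup>2)"
    using assms by (intro mult_pos_pos) (auto simp: power_less_one_iff abs_square_less_1)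
  then have "0 < 1 - (norm (disc_aut k c z))\<^sup>2"
    unfolding disc_aut_norm[OF assms, symmetric] by (simp add: zero_less_mult_iff)
  then show ?thesis by (simp add: abs_square_less_1)
qed

lemma disc_aut_inj:
  assumes "norm k = 1" "norm c < 1" "norm z < 1" "norm w < 1" "disc_aut k c z = disc_aut k c w"
  shows "z = w"
proof -
  have "k \<noteq> 0" using assms(1) by auto
  with assms(5) have "(z + c) * (1 + cnj c * w) = (w + c) * (1 + cnj c * z)"
    using disc_aut_denominator_nonzero[OF assms(2,3)] disc_aut_denominator_nonzero[OF assms(2,4)]
    by (simp add: disc_aut_def frac_eq_eq)
  then have "(z - w) * (1 - c * cnj c) = 0" by (simp add: algebra_simps)
  moreover have "1 - c * cnj c \<noteq> 0"
    using disc_aut_denominator_nonzero[of c "- c"] assms(2) by (simp add: mult.commute)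
  ultimately show ?thesis by simp
qed

text \<open>
  The chain rule for the Schwarzian, on the level of solutions: if \<open>T\<close> is the automorphism, then
  \<open>T' = m / (1 + cnj c z)\<^sup>2\<close>, and multiplying \<open>w \<circ> T\<close> by \<open>(T')\<^sup>-\<^sup>1\<^sup>/\<^sup>2\<close>, up to a constant,
  removes the first-order term. As the factor is affine, no new zeroth-order term appears, and the
  coefficient becomes \<open>(q \<circ> T) T'\<^sup>2\<close>.
\<close>

lemma solves_on_disc_aut:
  assumes w: "solves_on (ball 0 1) q w w'" and k: "norm k = 1" and c: "norm c < 1"
  defines "m \<equiv> k * (1 - c * cnj c)"
  shows "solves_on (ball 0 1) (\<lambda>z. q (disc_aut k c z) * (m / (1 + cnj c * z)\<^sup>2)\<^sup>2)
           (\<lambda>z. (1 + cnj c * z) * w (disc_aut k c z))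
           (\<lambda>z. cnj c * w (disc_aut k c z) + m / (1 + cnj c * z) * w' (disc_aut k c z))"
  unfolding solves_on_def
proof (intro ballI conjI)
  fix z :: complex assume z: "z \<in> ball 0 1"
  have L: "1 + cnj c * z \<noteq> 0" using disc_aut_denominator_nonzero[OF c] z by simp
  have T: "disc_aut k c z \<in> ball 0 1" using disc_aut_in_ball[OF k c] z by simp
  have dT: "(disc_aut k c has_field_derivative m / (1 + cnj c * z)\<^sup>2) (at z)"
    unfolding disc_aut_def [abs_def] m_def
    by (rule derivative_eq_intros refl L)+ (use L in \<open>simp add: field_simps power2_eq_square\<close>)
  note dw = DERIV_chain2[OF solves_onD(1)[OF w T] dT] DERIV_chain2[OF solves_onD(2)[OF w T] dT]
  define L where "L z = 1 + cnj c * z" for z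
  have dL: "(L has_field_derivative cnj c) (at z)"
    unfolding L_def by (auto intro!: derivative_eq_intros)
  have L0: "L z \<noteq> 0" using L by (simp add: L_def)
  note fold_L = L_def[symmetric]
  note dw' = dw[unfolded fold_L]
  show "((\<lambda>z. (1 + cnj c * z) * w (disc_aut k c z)) has_field_derivative
      cnj c * w (disc_aut k c z) + m / (1 + cnj c * z) * w' (disc_aut k c z)) (at z)"
    unfolding fold_L
    by (rule DERIV_cong[OF DERIV_mult[OF dL dw'(1)]])
       (use L0 in \<open>simp add: field_simps power2_eq_square\<close>)
  show "((\<lambda>z. cnj c * w (disc_aut k c z) + m / (1 + cnj c * z) * w' (disc_aut k c z))
      has_field_derivative - (q (disc_aut k c z) * (m / (1 + cnj c * z)\<^sup>2)\<^sup>2) *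
        ((1 + cnj c * z) * w (disc_aut k c z))) (at z)"
    unfolding fold_L
    by (rule DERIV_cong[OF DERIV_add[OF DERIV_cmult[OF dw'(1)]
          DERIV_mult[OF DERIV_divide[OF DERIV_const dL L0] dw'(2)]]])
       (use L0 in \<open>simp add: field_simps power2_eq_square\<close>)
qed

lemma cnj_mult_norm_square: "1 - c * cnj c = of_real (1 - (norm c)\<^sup>2)"
  by (simp only: of_real_diff of_real_1 complex_norm_square)

text \<open>
  The quotient is the parameter \<open>c'\<close> of the automorphism with parameter \<open>c\<close> precomposed with the
  translation of \<open>(-1, 1)\<close> that sends \<open>0\<close> to \<open>s\<close>. Its real part vanishes at a root of the quadratic
  polynomial \<open>g\<close> below, which changes sign on \<open>[-1, 1]\<close>.
\<close>

lemma orthogonal_parameter_exists: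
  assumes "norm (c :: complex) < 1"
  obtains s :: real where "-1 < s" "s < 1" "Re ((of_real s + c) / (1 + c * of_real s)) = 0"
proof -
  define g where "g s = Re c * s\<^sup>2 + (1 + (norm c)\<^sup>2) * s + Re c" for s :: real
  have m: "\<bar>Re c\<bar> \<le> norm c" by (rule abs_Re_le_cmod)
  have sq: "0 < (1 - norm c)\<^sup>2" using assms by simp
  then have "2 * \<bar>Re c\<bar> < 1 + (norm c)\<^sup>2" using m by (simp add: power2_eq_square algebra_simps)
  then have g: "g (-1) < 0" "0 < g 1" by (auto simp: g_def)
  have "\<exists>s\<ge>-1. s \<le> 1 \<and> g s = 0"
    by (rule IVT') (use g in \<open>auto simp: g_def intro!: continuous_intros\<close>)
  then obtain s where s: "-1 \<le> s" "s \<le> 1" "g s = 0" by blast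
  with g have s1: "-1 < s" "s < 1" by (auto simp: less_le)
  have "Re (of_real s + c) * Re (1 + c * of_real s) + Im (of_real s + c) * Im (1 + c * of_real s) = g s"
    unfolding g_def cmod_power2 by (simp add: algebra_simps power2_eq_square)
  then have "Re ((of_real s + c) / (1 + c * of_real s)) = 0"
    using s(3) by (simp add: Re_divide)
  with s1 that show thesis by blast
qed

text \<open>
  The choice \<open>Re c = 0\<close> places the point of the geodesic nearest to the origin at the parameter
  \<open>0\<close>; for real \<open>x\<close> it makes \<open>\<bar>1 + cnj c x\<bar> \<ge> 1\<close>, and then \<open>disc_aut_norm\<close> shows that the automorphism
  does not decrease \<open>\<bar>x\<bar>\<close>. An automorphism through the two given points is easily found; a real
  translation along its geodesic achieves the normalisation.
\<close>

lemma geodesic_normal_form: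
  assumes z: "norm z1 < 1" "norm z2 < 1" "z1 \<noteq> z2"
  obtains k c :: complex and x1 x2 :: real
  where "norm k = 1" "norm c < 1" "Re c = 0" "-1 < x1" "x1 < x2" "x2 < 1"
    "disc_aut k c (of_real x1) = z1" "disc_aut k c (of_real x2) = z2"
proof -
  \<comment> \<open>Moving \<open>z1\<close> to \<open>0\<close> and then \<open>z2\<close> to the positive real axis gives an automorphism, with
    parameters \<open>k0\<close> and \<open>c0\<close>, that maps \<open>0\<close> to \<open>z1\<close> and \<open>\<rho>\<close> to \<open>z2\<close>.\<close>
  define \<zeta> where "\<zeta> = disc_aut 1 (- z1) z2"
  define \<rho> where "\<rho> = norm \<zeta>"
  define k0 where "k0 = sgn \<zeta>"
  define c0 where "c0 = cnj k0 * z1"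
  have d0: "1 - cnj z1 * z2 \<noteq> 0" using disc_aut_denominator_nonzero[of "- z1" z2] z by simp
  have "\<zeta> \<noteq> 0" using z d0 by (simp add: \<zeta>_def disc_aut_def)
  then have \<rho>: "0 < \<rho>" "\<rho> < 1" and k0: "norm k0 = 1" "k0 * of_real \<rho> = \<zeta>"
    using disc_aut_in_ball[of 1 "- z1" z2] z
    by (auto simp: \<rho>_def \<zeta>_def[symmetric] k0_def norm_sgn) (simp add: sgn_eq)
  have kk: "k0 * cnj k0 = 1" using k0(1) by (simp add: complex_norm_square[symmetric])
  have c0: "norm c0 < 1" using z k0 by (simp add: c0_def norm_mult)
  have T0: "disc_aut k0 c0 0 = z1" using kk by (simp add: disc_aut_def c0_def mult.assoc[symmetric])
  have T\<rho>: "disc_aut k0 c0 (of_real \<rho>) = z2"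
  proof -
    have "1 + cnj z1 * \<zeta> \<noteq> 0"
      using disc_aut_denominator_nonzero[of z1 \<zeta>] z \<rho> by (simp add: \<rho>_def)
    moreover have "k0 * (of_real \<rho> + c0) = \<zeta> + z1"
    proof -
      have "k0 * (of_real \<rho> + c0) = k0 * of_real \<rho> + (k0 * cnj k0) * z1"
        by (simp add: c0_def algebra_simps)
      then show ?thesis by (simp only: kk k0(2) mult_1_left)
    qed
    moreover have "1 + cnj c0 * of_real \<rho> = 1 + cnj z1 * \<zeta>"
      using k0(2) by (simp add: c0_def mult.commute mult.left_commute)
    ultimately have "disc_aut k0 c0 (of_real \<rho>) = (\<zeta> + z1) / (1 + cnj z1 * \<zeta>)"
      by (simp add: disc_aut_def)
    moreover have "\<zeta> + z1 = z2 * (1 + cnj z1 * \<zeta>)"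
      using d0 by (simp add: \<zeta>_def disc_aut_def field_simps)
    ultimately show ?thesis using \<open>1 + cnj z1 * \<zeta> \<noteq> 0\<close> by simp
  qed
  obtain s where s: "-1 < s" "s < 1" "Re ((of_real s + c0) / (1 + c0 * of_real s)) = 0"
    using orthogonal_parameter_exists[OF c0] by blast
  \<comment> \<open>The automorphism with parameters \<open>k\<close> and \<open>c\<close> is the one with parameters \<open>k0\<close> and \<open>c0\<close>
    after the translation inverse to \<open>R\<close> below.\<close>
  define c where "c = (of_real s + c0) / (1 + c0 * of_real s)"
  define k where "k = k0 * (1 + c0 * of_real s) / (1 + cnj c0 * of_real s)"
  have D: "1 + c0 * of_real s \<noteq> 0" "1 + cnj c0 * of_real s \<noteq> 0"
    using disc_aut_denominator_nonzero[of c0 "of_real s"]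
          disc_aut_denominator_nonzero[of "cnj c0" "of_real s"] c0 s by auto
  have nD: "norm (1 + c0 * of_real s) = norm (1 + cnj c0 * of_real s)"
    by (subst complex_mod_cnj[symmetric]) simp
  have "norm k = 1" using D nD k0 by (simp add: k_def norm_mult norm_divide)
  moreover have "norm c < 1"
    using disc_aut_in_ball[of 1 c0 "of_real s"] c0 s nD
    by (simp add: c_def disc_aut_def norm_divide)
  moreover have "Re c = 0" using s by (simp add: c_def)
  moreover define R where "R x = (x - s) / (1 - x * s)" for x
  have "s\<^sup>2 < 1" using s by (simp add: abs_square_less_1)
  have T: "disc_aut k c (of_real (R x)) = disc_aut k0 c0 (of_real x)" if "1 - x * s \<noteq> 0" "norm x < 1" for x
  proof -
    let ?x = "of_real x :: complex" and ?s = "of_real s :: complex"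
    have s2: "1 - ?s\<^sup>2 \<noteq> 0" using \<open>s\<^sup>2 < 1\<close> by (simp flip: of_real_power add: of_real_eq_1_iff)
    have X: "1 - ?x * ?s \<noteq> 0" using that(1) by (metis of_real_1 of_real_diff of_real_eq_0_iff of_real_mult)
    have E: "1 + cnj c0 * ?x \<noteq> 0" using disc_aut_denominator_nonzero[of c0 ?x] c0 that by simp
    have "of_real (R x) + c = (1 - ?s\<^sup>2) * (?x + c0) / ((1 - ?x * ?s) * (1 + c0 * ?s))"
      using X D by (simp add: R_def c_def field_simps power2_eq_square)
    moreover have "1 + cnj c * of_real (R x) = (1 - ?s\<^sup>2) * (1 + cnj c0 * ?x) / ((1 - ?x * ?s) * (1 + cnj c0 * ?s))"
    proof -
      let ?M = "(1 - ?x * ?s) * (1 + cnj c0 * ?s)" and ?N = "(?x - ?s) * (?s + cnj c0)"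
      have "?M \<noteq> 0" using X D by simp
      then have "1 + ?N / ?M = (?M + ?N) / ?M" by (metis add_divide_distrib divide_self)
      also have "?M + ?N = (1 - ?s\<^sup>2) * (1 + cnj c0 * ?x)" by (simp add: algebra_simps power2_eq_square)
      finally show ?thesis by (simp add: R_def c_def mult.commute)
    qed
    ultimately show ?thesis
      using X D E s2 by (simp add: disc_aut_def k_def)
  qed
  have rs: "1 - \<rho> * s > 0" using \<rho> s
    by (smt (verit) mult_less_cancel_right1 mult_nonneg_nonpos mult_right_less_imp_less)
  moreover have "-1 < R 0" using s by (simp add: R_def)
  moreover have "R 0 < R \<rho>"
  proof -
    have "R \<rho> - R 0 = \<rho> * (1 - s\<^sup>2) / (1 - \<rho> * s)" using rs by (simp add: R_def field_simps power2_eq_square)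
    also have "\<dots> > 0" using \<rho> \<open>s\<^sup>2 < 1\<close> rs by simp
    finally show ?thesis by simp
  qed
  moreover have "R \<rho> < 1"
  proof -
    have "0 < (1 - \<rho>) * (1 + s)" using \<rho> s by simp
    then show ?thesis using rs by (simp add: R_def algebra_simps)
  qed
  moreover have "disc_aut k c (of_real (R 0)) = z1" "disc_aut k c (of_real (R \<rho>)) = z2"
    using T[of 0] T[of \<rho>] T0 T\<rho> rs \<rho> by auto
  ultimately show thesis using that by blast
qed

section \<open>Univalence and sharpness for a general majorant\<close>

text \<open>
  If \<open>f z1 = f z2\<close>, then \<open>(f - f z1) v\<close>, transported to the interval by the automorphism \<open>T\<close> of
  \<open>geodesic_normal_form\<close>, vanishes at two points of \<open>(-1, 1)\<close>. For its coefficient \<open>q\<close>,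
  \<open>(1 - x\<^sup>2)\<^sup>2 \<bar>q x\<bar> = (1 - \<bar>T x\<bar>\<^sup>2)\<^sup>2 \<bar>Sf (T x)\<bar> / 2
  \<le> (1 - \<bar>T x\<bar>\<^sup>2)\<^sup>2 p \<bar>T x\<bar> \<le> (1 - x\<^sup>2)\<^sup>2 p x\<close>
  because \<open>\<bar>T x\<bar> \<ge> \<bar>x\<bar>\<close>. By \<open>disconjugate\<close> it vanishes on a whole segment, so \<open>f\<close> is constant on
  an arc, contrary to local univalence.
\<close>

theorem nehari_criterion:
  fixes u u' p :: "real \<Rightarrow> real"
  assumes u: "solves_on {-1<..<1} p u u'" "\<And>x. x \<in> {-1<..<1} \<Longrightarrow> u x > 0"
    and p: "\<And>x. p (- x) = p x"
      "\<And>s t. 0 \<le> s \<Longrightarrow> s \<le> t \<Longrightarrow> t < 1 \<Longrightarrow> (1 - t\<^sup>2)\<^sup>2 * p t \<le> (1 - s\<^sup>2)\<^sup>2 * p s"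
    and f: "f holomorphic_on ball 0 1" "locally_univalent_on f (ball 0 1)"
    and S: "\<And>z. z \<in> ball 0 1 \<Longrightarrow> norm (schwarzian f z) \<le> 2 * p (norm z)"
  shows "inj_on f (ball 0 1)"
proof (rule inj_onI, rule ccontr)
  fix z1 z2 assume z: "z1 \<in> ball 0 1" "z2 \<in> ball 0 1" and eq: "f z1 = f z2" and ne: "z1 \<noteq> z2"
  from z have "norm z1 < 1" "norm z2 < 1" by auto
  from geodesic_normal_form[OF this ne] obtain k c x1 x2 where k: "norm k = 1" and c: "norm c < 1" "Re c = 0"
    and x: "-1 < x1" "x1 < x2" "x2 < 1"
    and T: "disc_aut k c (of_real x1) = z1" "disc_aut k c (of_real x2) = z2"
    by metis
  obtain v v' where v: "solves_on (ball 0 1) (\<lambda>z. schwarzian f z / 2) v v'"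
    "\<And>z. z \<in> ball 0 1 \<Longrightarrow> deriv f z * (v z)\<^sup>2 = 1"
    using schwarzian_linearisation[OF f] by blast
  define W where "W z = (1 + cnj c * z) * ((1 * f (disc_aut k c z) + - f z1) * v (disc_aut k c z))" for z
  define m where "m = k * (1 - c * cnj c)"
  define q where "q z = schwarzian f (disc_aut k c z) / 2 * (m / (1 + cnj c * z)\<^sup>2)\<^sup>2" for z
  obtain W' where W: "solves_on (ball 0 1) q W W'"
    using solves_on_disc_aut[OF solves_on_combination[OF f(1) open_ball v, of 1 "- f z1"] k c(1)]
    unfolding W_def q_def m_def by blast
  have bound: "norm (q (of_real x)) \<le> p x" if x: "x \<in> {-1<..<1}" for x
  proof -
    let ?x = "of_real x :: complex"
    let ?t = "norm (disc_aut k c ?x)"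
    have nx: "norm ?x < 1" using x by auto
    have t1: "?t < 1" by (rule disc_aut_in_ball[OF k c(1) nx])
    have x2: "x\<^sup>2 < 1" using x by (simp add: abs_square_less_1 abs_less_iff)
    define l where "l = (norm (1 + cnj c * ?x))\<^sup>2"
    have "l = 1 + (norm c)\<^sup>2 * x\<^sup>2"
      unfolding l_def cmod_power2 using c(2) by (simp add: power_mult_distrib)
    then have l: "l \<ge> 1" by simp
    have nT: "l * (1 - ?t\<^sup>2) = (1 - x\<^sup>2) * (1 - (norm c)\<^sup>2)"
      using disc_aut_norm[OF k c(1) nx] by (simp add: l_def)
    have "1 - ?t\<^sup>2 \<ge> 0" using t1 by (simp add: abs_square_le_1)
    then have "1 - ?t\<^sup>2 \<le> l * (1 - ?t\<^sup>2)" using l by (simp add: mult_le_cancel_right1)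
    also have "\<dots> \<le> (1 - x\<^sup>2) * 1" unfolding nT using x2 by (intro mult_left_mono) auto
    finally have "\<bar>x\<bar>\<^sup>2 \<le> ?t\<^sup>2" by simp
    then have xt: "\<bar>x\<bar> \<le> ?t" by (rule power2_le_imp_le) simp
    have "norm m = 1 - (norm c)\<^sup>2"
      using k c(1) by (simp add: m_def norm_mult cnj_mult_norm_square abs_square_le_1 del: of_real_diff)
    then have "norm (q ?x) = norm (schwarzian f (disc_aut k c ?x)) / 2 * ((1 - (norm c)\<^sup>2) / l)\<^sup>2"
      by (simp add: q_def norm_mult norm_divide norm_power l_def)
    also have "(1 - (norm c)\<^sup>2) / l = (1 - ?t\<^sup>2) / (1 - x\<^sup>2)"
      using nT l x2 by (simp add: field_simps)
    also have "norm (schwarzian f (disc_aut k c ?x)) / 2 * ((1 - ?t\<^sup>2) / (1 - x\<^sup>2))\<^sup>2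
        \<le> p ?t * ((1 - ?t\<^sup>2) / (1 - x\<^sup>2))\<^sup>2"
      using S[of "disc_aut k c ?x"] t1 by (intro mult_right_mono) auto
    also have "\<dots> = ((1 - ?t\<^sup>2)\<^sup>2 * p ?t) / (1 - x\<^sup>2)\<^sup>2" by (simp add: power_divide)
    also have "\<dots> \<le> ((1 - \<bar>x\<bar>\<^sup>2)\<^sup>2 * p \<bar>x\<bar>) / (1 - x\<^sup>2)\<^sup>2"
      by (intro divide_right_mono p(2) xt t1) auto
    also have "\<dots> = p x" using x2 p(1)[of x] by (cases "x \<ge> 0") auto
    finally show ?thesis .
  qed
  have W0: "W (of_real x) = 0" if "x \<in> {x1..x2}" for x
  proof -
    have in_ball: "of_real r \<in> ball (0::complex) 1" if "r \<in> {-1<..<1}" for r using that by auto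
    have dW: "((\<lambda>x. Re (W (of_real x))) has_real_derivative Re (W' (of_real r))) (at r)"
      "((\<lambda>x. Im (W (of_real x))) has_real_derivative Im (W' (of_real r))) (at r)"
      "((\<lambda>x. Re (W' (of_real x))) has_real_derivative Re (- q (of_real r) * W (of_real r))) (at r)"
      "((\<lambda>x. Im (W' (of_real x))) has_real_derivative Im (- q (of_real r) * W (of_real r))) (at r)"
      if "r \<in> {-1<..<1}" for r
      using DERIV_Re_Im_of_real[OF solves_onD(1)[OF W in_ball[OF that]]]
        DERIV_Re_Im_of_real[OF solves_onD(2)[OF W in_ball[OF that]]] by auto
    have WT: "W (of_real x1) = 0" "W (of_real x2) = 0" using T eq by (auto simp: W_def)
    have qp: "Re (q (of_real r)) \<le> p r" if "r \<in> {-1<..<1}" for r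
      using bound[OF that] complex_Re_le_cmod order_trans by blast
    have "Re (W (of_real x)) = 0 \<and> Im (W (of_real x)) = 0"
      by (rule conjI; rule disconjugate[OF u, of "\<lambda>x. Re (W (of_real x))" "\<lambda>x. Re (W' (of_real x))"
            "\<lambda>x. Re (q (of_real x))" "\<lambda>x. Im (q (of_real x))"
            "\<lambda>x. Im (W (of_real x))" "\<lambda>x. Im (W' (of_real x))" x1 x2])
         (use dW qp x WT that in \<open>auto simp: algebra_simps\<close>)
    then show ?thesis by (simp add: complex_eq_iff)
  qed
  have fz1: "f (disc_aut k c (of_real x)) = f z1" if "x \<in> {x1..x2}" for x
  proof -
    have nx: "norm (of_real x :: complex) < 1" using that x by auto
    have "v (disc_aut k c (of_real x)) \<noteq> 0"
      using v(2)[of "disc_aut k c (of_real x)"] disc_aut_in_ball[OF k c(1) nx] by auto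
    then show ?thesis
      using W0[OF that] disc_aut_denominator_nonzero[OF c(1) nx] by (auto simp: W_def)
  qed
  obtain U where U: "open U" "z1 \<in> U" "U \<subseteq> ball 0 1" "inj_on f U"
    using f(2) z(1) unfolding locally_univalent_on_def by blast
  \<comment> \<open>Points of the arc close to \<open>z1\<close> lie in a neighbourhood where \<open>f\<close> is injective.\<close>
  have "isCont (\<lambda>x. disc_aut k c (of_real x)) x1"
    unfolding disc_aut_def
    using disc_aut_denominator_nonzero[OF c(1), of "of_real x1"] x by (intro continuous_intros) auto
  then have "((\<lambda>x. disc_aut k c (of_real x)) \<longlongrightarrow> z1) (at_right x1)"
    using T(1) by (metis isCont_def tendsto_within_subset subset_UNIV)
  then have "\<forall>\<^sub>F x in at_right x1. disc_aut k c (of_real x) \<in> U"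
    using U by (intro topological_tendstoD) auto
  moreover have "\<forall>\<^sub>F x in at_right x1. x1 < x \<and> x < x2"
    using x(2) unfolding eventually_at_right_field by blast
  ultimately have "\<forall>\<^sub>F x in at_right x1. disc_aut k c (of_real x) \<in> U \<and> x1 < x \<and> x < x2"
    by (rule eventually_conj)
  then obtain y where y: "disc_aut k c (of_real y) \<in> U" "x1 < y" "y < x2"
    using eventually_happens'[OF trivial_limit_at_right_real] by blast
  have "disc_aut k c (of_real y) = disc_aut k c (of_real x1)"
    using inj_onD[OF U(4) fz1[of y] y(1) U(2)] y T by simp
  then have "of_real y = (of_real x1 :: complex)"
    by (rule disc_aut_inj[OF k c(1), rotated 2]) (use x y in auto)
  with y show False by simp
qed

lemma holomorphic_nonzero_on_real_interval:
  assumes g: "g holomorphic_on ball 0 1" "z \<in> ball 0 1" "g z \<noteq> 0"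
    and ab: "-1 \<le> a" "a < b" "b \<le> 1"
  obtains x where "a < x" "x < b" "g (of_real x) \<noteq> 0"
proof (rule ccontr)
  assume "\<not> thesis"
  with that have 0: "g (of_real x) = 0" if "a < x" "x < b" for x using \<open>a < x\<close> \<open>x < b\<close> by blast
  define m where "m = (a + b) / 2"
  have m: "a < m" "m < b" using ab by (auto simp: m_def field_simps)
  have lim: "m islimpt {m<..<b}" by (rule islimpt_greaterThanLessThan1[OF m(2)])
  have "(of_real m :: complex) islimpt of_real ` {m<..<b}"
    unfolding islimpt_approachable
  proof (intro allI impI)
    fix e :: real assume "e > 0"
    then obtain y where "y \<in> {m<..<b}" "y \<noteq> m" "dist y m < e"
      using lim unfolding islimpt_approachable by blast
    then show "\<exists>x'\<in>of_real ` {m<..<b}. x' \<noteq> (of_real m :: complex) \<and> dist x' (of_real m) < e"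
      by (intro bexI[of _ "of_real y"]) auto
  qed
  note lim' = this
  have "g z = 0"
    by (rule analytic_continuation[OF g(1) open_ball connected_ball _ _ lim' _ g(2)])
       (use m ab 0 in auto)
  with g(3) show False by simp
qed

text \<open>
  The bound on \<open>u\<^sup>2\<close> makes the integral of \<open>u\<^sup>-\<^sup>2\<close> diverge at both ends, so \<open>u\<close> is only just
  zero-free: any larger coefficient \<open>Sf / 2\<close> produces a solution \<open>w = (\<alpha> f + \<beta>) v\<close> with a zero on each
  side of \<open>0\<close>. Both zeros are solutions of \<open>\<alpha> f + \<beta> = 0\<close>, hence \<open>f\<close> takes the same value there.
  By the identity theorem, \<open>Sf\<close> different from \<open>2 P\<close> somewhere in the disc implies
  strict inequality somewhere on each half of the interval.
\<close>

theorem sharp_criterion_if_singular_solution: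
  fixes u u' p :: "real \<Rightarrow> real"
  assumes P: "P holomorphic_on ball 0 1" "\<And>x. x \<in> {-1<..<1} \<Longrightarrow> P (of_real x) = of_real (p x)"
    and u: "solves_on {-1<..<1} p u u'" "\<And>x. x \<in> {-1<..<1} \<Longrightarrow> u x > 0"
    and M: "\<And>x. x \<in> {-1<..<1} \<Longrightarrow> (u x)\<^sup>2 \<le> M * (1 - x\<^sup>2)"
  shows "sharp_criterion P"
  unfolding sharp_criterion_def
proof (intro allI impI notI)
  fix f
  assume f: "f holomorphic_on ball 0 1" "locally_univalent_on f (ball 0 1)"
    and S: "\<forall>x::real. -1 < x \<and> x < 1 \<longrightarrow> schwarzian f (of_real x) \<in> \<real> \<and>
              Re (schwarzian f (of_real x)) \<ge> 2 * Re (P (of_real x))"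
    and ne: "\<exists>z\<in>ball 0 1. schwarzian f z \<noteq> 2 * P z"
    and inj: "inj_on f (ball 0 1)"
  obtain v v' where v: "solves_on (ball 0 1) (\<lambda>z. schwarzian f z / 2) v v'"
    "\<And>z. z \<in> ball 0 1 \<Longrightarrow> deriv f z * (v z)\<^sup>2 = 1"
    using schwarzian_linearisation[OF f] by blast
  have v0: "v z \<noteq> 0" if "z \<in> ball 0 1" for z using v(2)[OF that] by auto
  \<comment> \<open>The Wronskian of \<open>v\<close> and \<open>f v\<close> is \<open>1\<close>, so any initial data can be prescribed; here
    they are those of \<open>u\<close> at \<open>0\<close>.\<close>
  define \<alpha> where "\<alpha> = v 0 * of_real (u' 0) - of_real (u 0) * v' 0"
  define \<beta> where "\<beta> = of_real (u 0) / v 0 - \<alpha> * f 0"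
  define w where "w z = (\<alpha> * f z + \<beta>) * v z" for z
  define w' where "w' z = \<alpha> / v z + (\<alpha> * f z + \<beta>) * v' z" for z
  have w: "solves_on (ball 0 1) (\<lambda>z. schwarzian f z / 2) w w'"
    using solves_on_combination[OF f(1) open_ball v] unfolding w_def w'_def by simp
  have init: "w 0 = of_real (u 0)" "w' 0 = of_real (u' 0)"
    using v0[of 0] by (simp_all add: w_def w'_def \<beta>_def) (simp add: \<alpha>_def field_simps)
  define q where "q x = Re (schwarzian f (of_real x)) / 2" for x :: real
  have q: "schwarzian f (of_real x) / 2 = of_real (q x)" "p x \<le> q x" if "x \<in> {-1<..<1}" for x
    using S that P(2)[OF that] by (auto simp: q_def complex_is_Real_iff complex_eq_iff)
  define y where "y x = Re (w (of_real x))" for x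
  define y' where "y' x = Re (w' (of_real x))" for x
  define s where "s x = Im (w (of_real x))" for x
  define s' where "s' x = Im (w' (of_real x))" for x
  note defs = y_def [abs_def] y'_def [abs_def] s_def [abs_def] s'_def [abs_def]
  have in_ball: "of_real x \<in> ball (0::complex) 1" if "x \<in> {-1<..<1}" for x using that by auto
  have ys: "solves_on {-1<..<1} q y y'" "solves_on {-1<..<1} q s s'"
    unfolding solves_on_def defs
    using DERIV_Re_Im_of_real[OF solves_onD(1)[OF w in_ball]]
      DERIV_Re_Im_of_real[OF solves_onD(2)[OF w in_ball]] q(1) by auto
  have D: "(\<lambda>z. schwarzian f z - 2 * P z) holomorphic_on ball 0 1"
    using f P locally_univalent_deriv_nonzero[OF f]
    unfolding schwarzian_def by (intro holomorphic_intros) auto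
  have strict: "p x < q x" if "schwarzian f (of_real x) - 2 * P (of_real x) \<noteq> 0" "x \<in> {-1<..<1}" for x
  proof -
    have "2 * of_real (q x) - 2 * of_real (p x) \<noteq> (0 :: complex)"
      using that q(1)[OF that(2)] P(2)[OF that(2)] by auto
    then have "q x \<noteq> p x" by auto
    with q(2)[OF that(2)] show ?thesis by simp
  qed
  from ne obtain z where z: "z \<in> ball 0 1" "schwarzian f z - 2 * P z \<noteq> 0" by auto
  have strict': "\<exists>x. a < x \<and> x < b \<and> p x < q x" if "-1 \<le> a" "a < b" "b \<le> 1" for a b
  proof (rule holomorphic_nonzero_on_real_interval[OF D z that])
    fix x assume "a < x" "x < b" "schwarzian f (of_real x) - 2 * P (of_real x) \<noteq> 0"
    with strict[of x] that show ?thesis by auto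
  qed
  obtain x1 where x1: "0 < x1" "x1 < 1" "p x1 < q x1" using strict'[of 0 1] by auto
  obtain x2 where x2: "-1 < x2" "x2 < 0" "p x2 < q x2" using strict'[of "-1" 0] by auto
  have "\<exists>x. 0 < x \<and> x < 1 \<and> y x = 0 \<and> s x = 0"
    by (rule common_zero_right[OF u M ys(1) _ _ ys(2) _ _ _ x1]) (use init q in \<open>auto simp: defs\<close>)
  then obtain r1 where r1: "0 < r1" "r1 < 1" "w (of_real r1) = 0"
    by (auto simp: defs complex_eq_iff)
  have "\<exists>x. 0 < x \<and> x < 1 \<and> y (- x) = 0 \<and> s (- x) = 0"
    by (rule common_zero_right[OF solves_on_reflect[OF u(1)] _ _ solves_on_reflect[OF ys(1)] _ _
          solves_on_reflect[OF ys(2)], of M "- x2"])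
       (use u(2) M[of "- x" for x] init q x2 in \<open>auto simp: defs\<close>)
  then obtain r2 where r2: "0 < r2" "r2 < 1" "w (of_real (- r2)) = 0"
    by (auto simp: defs complex_eq_iff)
  have root: "\<alpha> * f (of_real r) + \<beta> = 0" if "w (of_real r) = 0" "r \<in> {-1<..<1}" for r
    using that v0[OF in_ball[of r]] by (simp add: w_def)
  have "\<alpha> \<noteq> 0"
  proof
    assume "\<alpha> = 0"
    with root[of r1] r1 have "w 0 = 0" by (simp add: w_def)
    with init u(2)[of 0] show False by simp
  qed
  have "f (of_real r1) = f (of_real (- r2))"
  proof -
    have "\<alpha> * f (of_real r1) = \<alpha> * f (of_real (- r2))"
      using root[OF r1(3)] root[OF r2(3)] r1 r2 by (simp add: add_eq_0_iff2)
    with \<open>\<alpha> \<noteq> 0\<close> show ?thesis by simp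
  qed
  then have "(of_real r1 :: complex) = of_real (- r2)"
    by (rule inj_onD[OF inj]) (use r1 r2 in auto)
  then have "r1 = - r2" by (simp only: of_real_eq_iff)
  with r1 r2 show False by simp
qed

section \<open>The majorant of the theorem and its positive solution\<close>

definition pfun_solution :: "real \<Rightarrow> real \<Rightarrow> real \<Rightarrow> real" where
  "pfun_solution a lam x = (1 - x\<^sup>2) powr a * exp (lam * x\<^sup>2)"

lemma pfun_of_real: "pfun a lam (of_real x) = of_real (pfun a lam x)"
  by (simp add: pfun_def)

lemma pfun_minus: "pfun a lam (- x) = pfun a lam x"
  by (simp add: pfun_def)

text \<open>
  With \<open>h = 2 \<lambda> x - 2 a x / (1 - x\<^sup>2)\<close>, the logarithmic derivative of \<open>pfun_solution\<close>, this reads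
  \<open>p = - h' - h\<^sup>2\<close>. The polymorphic form serves both the real solution and the complex extremal function.
\<close>

lemma pfun_riccati:
  "pfun a lam x = 2 * of_real a * (1 + x\<^sup>2) / (1 - x\<^sup>2)\<^sup>2 - 2 * of_real lam
     - (2 * of_real lam * x - 2 * of_real a * x / (1 - x\<^sup>2))\<^sup>2"
proof -
  define r where "r = inverse (1 - x\<^sup>2)"
  have r2: "inverse ((1 - x\<^sup>2)\<^sup>2) = r\<^sup>2" by (simp add: r_def power_inverse)
  show ?thesis
    unfolding pfun_def divide_inverse r2 r_def[symmetric]
    by (simp add: algebra_simps power2_eq_square)
qed

lemma one_minus_square_pos: "x \<in> {-1<..<1} \<Longrightarrow> 0 < 1 - (x :: real)\<^sup>2"
  by (simp add: abs_square_less_1 abs_less_iff)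

lemma pfun_solution_pos: "x \<in> {-1<..<1} \<Longrightarrow> 0 < pfun_solution a lam x"
  using one_minus_square_pos[of x] by (simp add: pfun_solution_def)

lemma pfun_solution_solves:
  "solves_on {-1<..<1} (pfun a lam) (pfun_solution a lam)
     (\<lambda>x. pfun_solution a lam x * (2 * lam * x - 2 * a * x / (1 - x\<^sup>2)))"
  unfolding solves_on_def
proof (intro ballI conjI)
  fix x :: real assume "x \<in> {-1<..<1}"
  note d = one_minus_square_pos[OF this]
  define h where "h x = 2 * lam * x - 2 * a * x / (1 - x\<^sup>2)" for x
  have dd: "((\<lambda>x. 1 - x\<^sup>2) has_real_derivative - 2 * x) (at x)"
    by (auto intro!: derivative_eq_intros)
  have "((\<lambda>x. (1 - x\<^sup>2) powr a) has_real_derivative a * (1 - x\<^sup>2) powr (a - 1) * (- 2 * x)) (at x)"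
    by (rule DERIV_chain2[OF has_real_derivative_powr[OF d] dd])
  moreover have "((\<lambda>x. exp (lam * x\<^sup>2)) has_real_derivative exp (lam * x\<^sup>2) * (2 * lam * x)) (at x)"
    by (auto intro!: derivative_eq_intros)
  ultimately have s: "(pfun_solution a lam has_real_derivative pfun_solution a lam x * h x) (at x)"
    unfolding pfun_solution_def [abs_def]
    by (rule DERIV_cong[OF DERIV_mult]) (use d in \<open>simp add: h_def powr_diff algebra_simps\<close>)
  then show "(pfun_solution a lam has_real_derivative pfun_solution a lam x * (2 * lam * x - 2 * a * x / (1 - x\<^sup>2))) (at x)"
    by (simp add: h_def)
  have "((\<lambda>x. 2 * a * x / (1 - x\<^sup>2)) has_real_derivative 2 * a * (1 + x\<^sup>2) / (1 - x\<^sup>2)\<^sup>2) (at x)"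
    by (rule DERIV_cong[OF DERIV_divide[OF DERIV_cmult[OF DERIV_ident] dd]])
       (use d in \<open>simp_all add: algebra_simps power2_eq_square\<close>)
  from DERIV_diff[OF DERIV_cmult[OF DERIV_ident, of "2 * lam"] this]
  have "(h has_real_derivative 2 * lam - 2 * a * (1 + x\<^sup>2) / (1 - x\<^sup>2)\<^sup>2) (at x)"
    by (simp add: h_def [abs_def])
  from DERIV_mult[OF s this]
  have "((\<lambda>x. pfun_solution a lam x * h x) has_real_derivative - pfun a lam x * pfun_solution a lam x) (at x)"
    by (rule DERIV_cong) (simp add: pfun_riccati h_def algebra_simps power2_eq_square)
  then show "((\<lambda>x. pfun_solution a lam x * (2 * lam * x - 2 * a * x / (1 - x\<^sup>2))) has_real_derivative
      - pfun a lam x * pfun_solution a lam x) (at x)"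
    by (simp add: h_def)
qed

text \<open>
  From \<open>2 a \<ge> 1\<close> and \<open>0 < 1 - x\<^sup>2 \<le> 1\<close> one gets \<open>(1 - x\<^sup>2)\<^sup>2\<^sup>a \<le> 1 - x\<^sup>2\<close>; this is where the lower bound on \<open>a\<close>
  enters the sharpness part.
\<close>

lemma pfun_solution_bound:
  assumes "1 / 2 \<le> a" "x \<in> {-1<..<1}"
  shows "(pfun_solution a lam x)\<^sup>2 \<le> exp (2 * \<bar>lam\<bar>) * (1 - x\<^sup>2)"
proof -
  note d = one_minus_square_pos[OF assms(2)]
  have "(pfun_solution a lam x)\<^sup>2 = (1 - x\<^sup>2) powr (2 * a) * exp (2 * lam * x\<^sup>2)"
  proof -
    have "(1 - x\<^sup>2) powr (2 * a) = ((1 - x\<^sup>2) powr a)\<^sup>2" by (simp only: mult_2 powr_add power2_eq_square)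
    moreover have "exp (2 * lam * x\<^sup>2) = (exp (lam * x\<^sup>2))\<^sup>2"
      using exp_double[of "lam * x\<^sup>2"] by (simp add: mult.assoc)
    ultimately show ?thesis by (simp add: pfun_solution_def power_mult_distrib)
  qed
  also have "\<dots> \<le> (1 - x\<^sup>2) powr 1 * exp (2 * \<bar>lam\<bar>)"
  proof (rule mult_mono)
    show "(1 - x\<^sup>2) powr (2 * a) \<le> (1 - x\<^sup>2) powr 1" using assms d by (intro powr_mono') auto
    have "lam * x\<^sup>2 \<le> \<bar>lam\<bar> * 1" using d by (intro mult_mono) auto
    then show "exp (2 * lam * x\<^sup>2) \<le> exp (2 * \<bar>lam\<bar>)" by simp
  qed (use d in auto)
  finally show ?thesis using d by (simp add: mult.commute)
qed

text \<open>
  In the variable \<open>y = x\<^sup>2\<close> the weighted function is a cubic polynomial \<open>N\<close>. The upper bound on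
  \<open>\<lambda>\<close> is equivalent, given \<open>\<lambda> \<le> a\<close>, to \<open>N' 0 \<le> 0\<close>, and the lower bound to
  \<open>N' 1 \<le> 0\<close>. Between the end points \<open>N'\<close> is monotone: decreasing if \<open>\<lambda> \<ge> 0\<close> and
  increasing if \<open>\<lambda> \<le> 0\<close>. So an estimate against one of the end points suffices.
\<close>

lemma pfun_weighted_antimono:
  fixes a lam s t :: real
  assumes lam: "(1 - 2 * a) / 4 \<le> lam" "lam \<le> 1 / 2 * ((1 + 2 * a) - sqrt (1 + 6 * a))"
    and a: "1 / 2 \<le> a" "a \<le> 1" and st: "0 \<le> s" "s \<le> t" "t < 1"
  shows "(1 - t\<^sup>2)\<^sup>2 * pfun a lam t \<le> (1 - s\<^sup>2)\<^sup>2 * pfun a lam s"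
proof -
  define N where "N y = 2 * a + 2 * a * y - 4 * a\<^sup>2 * y + 8 * a * lam * y * (1 - y)
    - (4 * lam\<^sup>2 * y + 2 * lam) * (1 - y)\<^sup>2" for y :: real
  define N' where "N' y = 2 * a - 4 * a\<^sup>2 + 8 * a * lam * (1 - 2 * y) - 4 * lam\<^sup>2 * (1 - y)\<^sup>2
    + 2 * (4 * lam\<^sup>2 * y + 2 * lam) * (1 - y)" for y :: real
  have N: "(1 - x\<^sup>2)\<^sup>2 * pfun a lam x = N (x\<^sup>2)" if x: "0 \<le> x" "x < 1" for x :: real
  proof -
    define d where "d = 1 - x\<^sup>2"
    have "d \<noteq> 0" using one_minus_square_pos[of x] x by (simp add: d_def)
    then show ?thesis
      unfolding pfun_def N_def d_def[symmetric] by (simp add: field_simps power2_eq_square)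
  qed
  have dN: "(N has_real_derivative N' y) (at y)" for y
    unfolding N_def N'_def
    by (auto intro!: derivative_eq_intros simp: algebra_simps power2_eq_square)
  define R where "R = sqrt (1 + 6 * a)"
  have R: "R\<^sup>2 = 1 + 6 * a" "R \<ge> 1" using a by (simp_all add: R_def)
  have R_le: "R \<le> (1 + 2 * a) - 2 * lam" using lam(2) by (simp add: R_def)
  then have "R\<^sup>2 \<le> ((1 + 2 * a) - 2 * lam)\<^sup>2" using R(2) by (intro power_mono) auto
  then have "1 + 6 * a \<le> ((1 + 2 * a) - 2 * lam)\<^sup>2" by (simp only: R(1))
  then have N0: "N' 0 \<le> 0" by (simp add: N'_def power2_eq_square algebra_simps)
  have "lam \<le> a" using R_le R(2) by simp
  have "2 * a * (1 - 2 * a - 4 * lam) \<le> 0" using a lam(1) by (intro mult_nonneg_nonpos) auto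
  then have N1: "N' 1 \<le> 0" by (simp add: N'_def power2_eq_square algebra_simps)
  have N'_le: "N' y \<le> 0" if y: "0 \<le> y" "y \<le> 1" for y
  proof (cases "lam \<ge> 0")
    case True
    have "N' y = N' 0 + 4 * (lam * y) * (4 * lam - 4 * a - 1) - 12 * (lam * y)\<^sup>2"
      by (simp add: N'_def power2_eq_square algebra_simps)
    also have "\<dots> \<le> 0"
    proof -
      have "0 \<le> lam * y" using True y by simp
      moreover have "4 * lam - 4 * a - 1 \<le> 0" using \<open>lam \<le> a\<close> by simp
      ultimately have "lam * y * (4 * lam - 4 * a - 1) \<le> 0" by (rule mult_nonneg_nonpos)
      moreover have "0 \<le> (lam * y)\<^sup>2" by simp
      ultimately show ?thesis using N0 by linarith
    qed
    finally show ?thesis .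
  next
    case False
    have "N' y = N' 1 + 4 * (lam * (1 - y)) * (4 * a + 2 * lam + 1) - 12 * (lam * (1 - y))\<^sup>2"
      by (simp add: N'_def power2_eq_square algebra_simps)
    also have "\<dots> \<le> 0"
    proof -
      have "lam * (1 - y) \<le> 0" using False y by (intro mult_nonpos_nonneg) auto
      moreover have "0 \<le> 4 * a + 2 * lam + 1" using lam(1) a by simp
      ultimately have "lam * (1 - y) * (4 * a + 2 * lam + 1) \<le> 0" by (rule mult_nonpos_nonneg)
      moreover have "0 \<le> (lam * (1 - y))\<^sup>2" by simp
      ultimately show ?thesis using N1 by linarith
    qed
    finally show ?thesis .
  qed
  have "s\<^sup>2 \<le> t\<^sup>2" using st by (simp add: power_mono)
  have "t\<^sup>2 < 1" using one_minus_square_pos[of t] st by simp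
  from \<open>s\<^sup>2 \<le> t\<^sup>2\<close> have "N (t\<^sup>2) \<le> N (s\<^sup>2)"
  proof (rule DERIV_nonpos_imp_nonincreasing)
    fix y assume "s\<^sup>2 \<le> y" "y \<le> t\<^sup>2"
    then have "0 \<le> y" "y \<le> 1" using \<open>t\<^sup>2 < 1\<close> zero_le_power2[of s] by linarith+
    with dN[of y] N'_le show "\<exists>d. (N has_real_derivative d) (at y) \<and> d \<le> 0" by blast
  qed
  then show ?thesis using N st by auto
qed

text \<open>
  The closed form of the expansion in powers of \<open>y = x\<^sup>2\<close>: the coefficient of \<open>y\<^sup>n\<close> with \<open>n \<ge> 2\<close> is
  \<open>2 a (1 + 4 \<lambda>) + 4 a (1 - a) n\<close>, and
  \<open>y\<^sup>2 / (1 - y) + y\<^sup>2 / (1 - y)\<^sup>2\<close> is the sum of all \<open>n y\<^sup>n\<close> with \<open>n \<ge> 2\<close>.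
\<close>

lemma pfun_expansion:
  fixes x :: "'a :: real_field"
  assumes "1 - x\<^sup>2 \<noteq> 0"
  shows "pfun a lam x = of_real (2 * a - 2 * lam)
    + of_real (6 * a - 4 * a\<^sup>2 + 8 * a * lam - 4 * lam\<^sup>2) * x\<^sup>2
    + of_real (2 * a * (1 + 4 * lam) + 4 * a * (1 - a)) * ((x\<^sup>2)\<^sup>2 / (1 - x\<^sup>2))
    + of_real (4 * a * (1 - a)) * ((x\<^sup>2)\<^sup>2 / (1 - x\<^sup>2)\<^sup>2)"
proof -
  define d where "d = 1 - x\<^sup>2"
  have d: "d \<noteq> 0" and x: "x\<^sup>2 = 1 - d" using assms by (auto simp: d_def)
  show ?thesis unfolding pfun_def d_def[symmetric] unfolding x
    using d by (simp add: field_simps power2_eq_square)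
qed

text \<open>
  All coefficients in \<open>pfun_expansion\<close> are nonnegative, so the triangle inequality and
  \<open>\<bar>1 - z\<^sup>2\<bar> \<ge> 1 - \<bar>z\<bar>\<^sup>2\<close> suffice. The coefficient of \<open>x\<^sup>2\<close> is
  \<open>6 a - 4 (a - \<lambda>)\<^sup>2\<close>, which explains the condition with \<open>(6 a)\<^sup>1\<^sup>/\<^sup>2\<close>.
\<close>

lemma pfun_self_majorant:
  assumes lam: "(1 - 2 * a) / 4 \<le> lam" "a - 1 / 2 * sqrt (6 * a) \<le> lam" "lam \<le> a"
    and a: "0 \<le> a" "a \<le> 1"
  shows "self_majorant (pfun a lam)"
  unfolding self_majorant_def
proof (intro conjI ballI)
  have ne: "1 - z\<^sup>2 \<noteq> 0" if "norm z < 1" for z :: complex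
  proof
    assume "1 - z\<^sup>2 = 0"
    then have "norm z ^ 2 = 1" by (metis eq_iff_diff_eq_0 norm_one norm_power)
    with that show False by (simp add: abs_square_eq_1)
  qed
  then show "pfun a lam holomorphic_on ball (0::complex) 1"
    unfolding pfun_def by (intro holomorphic_intros) auto
  fix z :: complex assume "z \<in> ball 0 1"
  then have z: "norm z < 1" by simp
  show "pfun a lam (complex_of_real (norm z)) \<in> \<real>" by (simp add: pfun_of_real)
  define r where "r = norm z"
  have d: "0 < 1 - r\<^sup>2" using z one_minus_square_pos[of r] by (simp add: r_def less_le_trans[OF _ norm_ge_zero])
  define c0 c1 c2 c3 where c: "c0 = 2 * a - 2 * lam"
    "c1 = 6 * a - 4 * a\<^sup>2 + 8 * a * lam - 4 * lam\<^sup>2"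
    "c2 = 2 * a * (1 + 4 * lam) + 4 * a * (1 - a)" "c3 = 4 * a * (1 - a)"
  have "c0 \<ge> 0" "c3 \<ge> 0" "c2 \<ge> 0" using lam a by (simp_all add: c)
  moreover have "c1 \<ge> 0"
  proof -
    have "a - lam \<le> sqrt (6 * a) / 2" "0 \<le> a - lam" using lam by auto
    then have "(a - lam)\<^sup>2 \<le> (sqrt (6 * a) / 2)\<^sup>2" by (intro power_mono)
    also have "\<dots> = 6 * a / 4" using a by (simp add: power_divide)
    finally show ?thesis by (simp add: c power2_eq_square algebra_simps)
  qed
  moreover have "norm (1 - z\<^sup>2) \<ge> 1 - r\<^sup>2"
    using norm_triangle_ineq2[of 1 "z\<^sup>2"] by (simp add: r_def norm_power)
  moreover have "norm ((z\<^sup>2)\<^sup>2 / (1 - z\<^sup>2)) \<le> (r\<^sup>2)\<^sup>2 / (1 - r\<^sup>2)"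
    "norm ((z\<^sup>2)\<^sup>2 / (1 - z\<^sup>2)\<^sup>2) \<le> (r\<^sup>2)\<^sup>2 / (1 - r\<^sup>2)\<^sup>2"
    using calculation d
    by (auto simp: norm_divide norm_power r_def[symmetric] intro!: frac_le power_mono)
  moreover have "pfun a lam z = of_real c0 + of_real c1 * z\<^sup>2 + of_real c2 * ((z\<^sup>2)\<^sup>2 / (1 - z\<^sup>2))
      + of_real c3 * ((z\<^sup>2)\<^sup>2 / (1 - z\<^sup>2)\<^sup>2)"
    using pfun_expansion[OF ne[OF z]] by (simp only: c)
  ultimately have "norm (pfun a lam z) \<le> c0 + c1 * r\<^sup>2 + c2 * ((r\<^sup>2)\<^sup>2 / (1 - r\<^sup>2)) + c3 * ((r\<^sup>2)\<^sup>2 / (1 - r\<^sup>2)\<^sup>2)"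
    by (simp only:, intro norm_triangle_le add_mono)
       (simp_all only: norm_mult norm_of_real norm_power r_def[symmetric] abs_of_nonneg mult_left_mono order_refl)
  also have "\<dots> = pfun a lam r"
    using pfun_expansion[of r a lam] d by (simp add: c)
  finally show "norm (pfun a lam z) \<le> Re (pfun a lam (complex_of_real (norm z)))"
    by (simp add: pfun_of_real r_def)
qed

section \<open>The extremal function\<close>

definition extremal_deriv :: "real \<Rightarrow> real \<Rightarrow> complex \<Rightarrow> complex" where
  "extremal_deriv a lam t = 1 / ((1 - t\<^sup>2) powr of_real (2 * a) * exp (of_real (2 * lam) * t\<^sup>2))"

lemma Re_one_minus_square_pos:
  assumes "norm (z :: complex) < 1"
  shows "0 < Re (1 - z\<^sup>2)"
proof -
  have "Re (z\<^sup>2) \<le> norm z ^ 2" by (metis complex_Re_le_cmod norm_power)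
  also have "\<dots> < 1" using assms by (simp add: abs_square_less_1)
  finally show ?thesis by simp
qed

lemma extremal_deriv_nonzero: "norm z < 1 \<Longrightarrow> extremal_deriv a lam z \<noteq> 0"
  using Re_one_minus_square_pos[of z] by (auto simp: extremal_deriv_def)

lemma DERIV_extremal_deriv:
  assumes z: "norm z < 1"
  shows "(extremal_deriv a lam has_field_derivative
    extremal_deriv a lam z * (4 * of_real a * z / (1 - z\<^sup>2) - 4 * of_real lam * z)) (at z)"
proof -
  have d: "1 - z\<^sup>2 \<notin> \<real>\<^sub>\<le>\<^sub>0" "1 - z\<^sup>2 \<noteq> 0"
    using Re_one_minus_square_pos[OF z] by (auto simp: complex_nonpos_Reals_iff)
  have dd: "((\<lambda>x. 1 - x\<^sup>2) has_field_derivative - 2 * z) (at z)"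
    by (auto intro!: derivative_eq_intros)
  define A where "A t = (1 - t\<^sup>2) powr (of_real (2 * a) :: complex)" for t
  define B where "B t = exp (of_real (2 * lam) * t\<^sup>2 :: complex)" for t
  have "(A has_field_derivative of_real (2 * a) * (1 - z\<^sup>2) powr (of_real (2 * a) - 1) * (- 2 * z)) (at z)"
    unfolding A_def by (rule DERIV_chain2[OF has_field_derivative_powr[OF d(1)] dd])
  then have dA: "(A has_field_derivative A z * (- 4 * of_real a * z / (1 - z\<^sup>2))) (at z)"
    by (rule DERIV_cong) (use d(2) in \<open>simp add: powr_diff A_def\<close>)
  have dB: "(B has_field_derivative B z * (4 * of_real lam * z)) (at z)"
    unfolding B_def by (auto intro!: derivative_eq_intros)
  have nz: "A z \<noteq> 0" "B z \<noteq> 0" using d(2) by (simp_all add: A_def B_def)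
  define e where "e = 4 * of_real a * z / (1 - z\<^sup>2)"
  have e': "- 4 * of_real a * z / (1 - z\<^sup>2) = - e" by (simp add: e_def)
  have "((\<lambda>t. 1 / (A t * B t)) has_field_derivative 1 / (A z * B z) * (e - 4 * of_real lam * z)) (at z)"
    by (rule DERIV_cong[OF DERIV_divide[OF DERIV_const DERIV_mult[OF dA[unfolded e'] dB]]])
       (use nz in \<open>simp_all add: field_simps\<close>)
  then show ?thesis by (simp add: extremal_deriv_def [abs_def] A_def B_def e_def)
qed

lemma DERIV_extremal:
  assumes z: "norm z < 1"
  shows "(extremal a lam has_field_derivative extremal_deriv a lam z) (at z)"
proof -
  have "extremal_deriv a lam holomorphic_on ball 0 1"
    unfolding holomorphic_on_open[OF open_ball]
    by (intro ballI exI, rule DERIV_extremal_deriv) simp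
  then obtain F where F: "\<And>x. x \<in> ball 0 1 \<Longrightarrow> (F has_field_derivative extremal_deriv a lam x) (at x within ball 0 1)"
    using holomorphic_convex_primitive'[OF convex_ball open_ball] by blast
  have eq: "extremal a lam w = F w - F 0" if "w \<in> ball 0 1" for w
  proof -
    have "path_image (linepath 0 w) \<subseteq> ball 0 1"
      using that by (simp add: closed_segment_subset)
    from contour_integral_primitive[OF F valid_path_linepath this]
    show ?thesis by (simp add: extremal_def extremal_deriv_def [abs_def] contour_integral_unique)
  qed
  have "((\<lambda>w. F w - F 0) has_field_derivative extremal_deriv a lam z) (at z)"
    using F[of z] z by (auto intro!: derivative_eq_intros simp: at_within_open[OF _ open_ball])
  then show ?thesis
    by (rule has_field_derivative_transform_within_open[of _ _ _ "ball 0 1"]) (use z eq in auto)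
qed

text \<open>
  The integrand is even, and the segments from \<open>0\<close> to \<open>z\<close> and to \<open>- z\<close> are opposite.
\<close>

lemma extremal_minus: "extremal a lam (- z) = - extremal a lam z"
proof -
  have "linepath 0 (- z) t = - linepath 0 z t" for t by (simp add: linepath_def)
  then show ?thesis
    unfolding extremal_def contour_integral_integral by simp
qed

lemma extremal_schwarzian:
  assumes z: "norm z < 1"
  shows "schwarzian (extremal a lam) z = 2 * pfun a lam z"
proof -
  have d: "1 - z\<^sup>2 \<noteq> 0" using Re_one_minus_square_pos[OF z] by auto
  have dd: "((\<lambda>x. 1 - x\<^sup>2) has_field_derivative - 2 * z) (at z)"
    by (auto intro!: derivative_eq_intros)
  have "((\<lambda>z. 4 * of_real a * z / (1 - z\<^sup>2)) has_field_derivative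
     4 * of_real a * (1 + z\<^sup>2) / (1 - z\<^sup>2)\<^sup>2) (at z)"
    by (rule DERIV_cong[OF DERIV_divide[OF DERIV_cmult[OF DERIV_ident] dd d]])
       (simp add: algebra_simps power2_eq_square)
  from DERIV_diff[OF this DERIV_cmult[OF DERIV_ident, of "4 * of_real lam"]]
  have "((\<lambda>z. 4 * of_real a * z / (1 - z\<^sup>2) - 4 * of_real lam * z) has_field_derivative
     4 * of_real a * (1 + z\<^sup>2) / (1 - z\<^sup>2)\<^sup>2 - 4 * of_real lam) (at z)"
    by simp
  then have "schwarzian (extremal a lam) z = 4 * of_real a * (1 + z\<^sup>2) / (1 - z\<^sup>2)\<^sup>2 - 4 * of_real lam
      - (4 * of_real a * z / (1 - z\<^sup>2) - 4 * of_real lam * z)\<^sup>2 / 2"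
    by (intro schwarzian_eq[of "ball 0 1" z _ "extremal_deriv a lam"])
       (use z DERIV_extremal DERIV_extremal_deriv extremal_deriv_nonzero in auto)
  also have "\<dots> = 2 * pfun a lam z"
  proof -
    define r where "r = inverse (1 - z\<^sup>2)"
    have r2: "inverse ((1 - z\<^sup>2)\<^sup>2) = r\<^sup>2" by (simp add: r_def power_inverse)
    show ?thesis
      unfolding pfun_riccati divide_inverse r2 r_def[symmetric]
      by (simp add: algebra_simps power2_eq_square)
  qed
  finally show ?thesis .
qed

lemma extremal_holomorphic: "extremal a lam holomorphic_on ball 0 1"
  unfolding holomorphic_on_open[OF open_ball]
  by (intro ballI exI, rule DERIV_extremal) simp

lemma extremal_locally_univalent: "locally_univalent_on (extremal a lam) (ball 0 1)"
  unfolding locally_univalent_on_def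
proof
  fix z :: complex assume z: "z \<in> ball 0 1"
  then have "deriv (extremal a lam) z \<noteq> 0"
    using DERIV_imp_deriv[OF DERIV_extremal] extremal_deriv_nonzero by auto
  from has_complex_derivative_locally_injective[OF extremal_holomorphic z open_ball this]
  obtain r where "r > 0" "ball z r \<subseteq> ball 0 1" "inj_on (extremal a lam) (ball z r)" .
  then show "\<exists>U. open U \<and> z \<in> U \<and> U \<subseteq> ball 0 1 \<and> inj_on (extremal a lam) U"
    by (intro exI[of _ "ball z r"]) auto
qed

section \<open>The criterion, the extremal function and sharpness\<close>

theorem theorem1:
  fixes a lam :: real
  shows
    "((1 - 2 * a) / 4 \<le> lam \<and> lam \<le> 1 / 2 * ((1 + 2 * a) - sqrt (1 + 6 * a)) \<and>
      1 / 2 \<le> a \<and> a \<le> 1 \<longrightarrow>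
        (\<forall>f. f holomorphic_on ball 0 1 \<and> locally_univalent_on f (ball 0 1) \<and>
             (\<forall>z\<in>ball 0 1. norm (schwarzian f z) \<le> 2 * pfun a lam (norm z)) \<longrightarrow>
             inj_on f (ball 0 1))) \<and>
     (max ((1 - 2 * a) / 4) (a - 1 / 2 * sqrt (6 * a)) \<le> lam \<and>
      lam \<le> 1 / 2 * ((1 + 2 * a) - sqrt (1 + 6 * a)) \<and>
      1 / 2 < a \<and> a \<le> 1 \<longrightarrow>
        self_majorant (pfun a lam) \<and>
        extremal a lam holomorphic_on ball 0 1 \<and>
        (\<forall>z\<in>ball 0 1. extremal a lam (- z) = - extremal a lam z) \<and>
        inj_on (extremal a lam) (ball 0 1)) \<and>
     (max ((1 - 2 * a) / 4) (a - 1 / 2 * sqrt (6 * a)) \<le> lam \<and>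
      lam \<le> 1 / 2 * ((1 + 2 * a) - sqrt (1 + 6 * a)) \<and>
      1 / 2 < a \<and> a \<le> 1 \<longrightarrow>
        sharp_criterion (pfun a lam))"
proof -
  let ?A = "(1 - 2 * a) / 4 \<le> lam \<and> lam \<le> 1 / 2 * ((1 + 2 * a) - sqrt (1 + 6 * a)) \<and>
      1 / 2 \<le> a \<and> a \<le> 1"
  let ?B = "max ((1 - 2 * a) / 4) (a - 1 / 2 * sqrt (6 * a)) \<le> lam \<and>
      lam \<le> 1 / 2 * ((1 + 2 * a) - sqrt (1 + 6 * a)) \<and> 1 / 2 < a \<and> a \<le> 1"
  have A: "inj_on f (ball 0 1)"
    if "?A" "f holomorphic_on ball 0 1" "locally_univalent_on f (ball 0 1)"
      "\<And>z. z \<in> ball 0 1 \<Longrightarrow> norm (schwarzian f z) \<le> 2 * pfun a lam (norm z)" for f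
    by (rule nehari_criterion[OF pfun_solution_solves pfun_solution_pos pfun_minus pfun_weighted_antimono])
       (use that in auto)
  have BA: "?A" if "?B" using that by auto
  have self: "self_majorant (pfun a lam)" if "?B"
  proof (rule pfun_self_majorant)
    define R where "R = sqrt (1 + 6 * a)"
    have "1 \<le> R" "2 * lam \<le> (1 + 2 * a) - R" using that by (auto simp: R_def)
    then show "lam \<le> a" by linarith
  qed (use that in auto)
  have inj: "inj_on (extremal a lam) (ball 0 1)" if "?B"
  proof (rule A[OF BA[OF that] extremal_holomorphic extremal_locally_univalent])
    fix z :: complex assume "z \<in> ball 0 1"
    then show "norm (schwarzian (extremal a lam) z) \<le> 2 * pfun a lam (norm z)"
      using self[OF that] extremal_schwarzian[of z a lam]
      by (auto simp: self_majorant_def norm_mult pfun_of_real)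
  qed
  have sharp: "sharp_criterion (pfun a lam)" if "?B"
  proof (rule sharp_criterion_if_singular_solution[OF _ _ pfun_solution_solves pfun_solution_pos pfun_solution_bound])
    show "pfun a lam holomorphic_on ball 0 1" using self[OF that] by (simp add: self_majorant_def)
  qed (use that pfun_of_real in auto)
  show ?thesis
    using A self inj sharp extremal_holomorphic extremal_minus by blast
qed

end
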